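(* Let $X$ and $Y$ be Hilbert spaces, $\Omega\subset X$ be a closed and convex set, and $S_i:X\rightrightarrows Y$, $i=1,2$, with $(\bar x,\bar y)\in\operatorname{gph}(S_1+S_2)|_\Omega$. Define $G:X\times Y\rightrightarrows Y\times Y$ by $$G(x,y):=\{(y_1,y_2)\in Y\times Y: y_1\in S_1(x),\ y_2\in S_2(x),\ y_1+y_2=y\},$$ fix $(\bar y_1,\bar y_2)\in G(\bar x,\bar y)$, and assume that $G$ is inner semicontinuous relative to $\Omega\times Y$ at $(\bar x,\bar y,\bar y_1,\bar y_2)$. Assume also that $\operatorname{gph}S_1|_\Omega$ and $\operatorname{gph}S_2|_\Omega$ are closed around $(\bar x,\bar y_1)$ and $(\bar x,\bar y_2)$, respectively, and that the qualification condition $$D_M^*(S_1)_\Omega(\bar x|\bar y_1)(0)\cap\big(-D_M^*(S_2)_\Omega(\bar x|\bar y_2)(0)\big)=\{0\}$$ holds. Suppose that $S_1$ and $S_2$ are PSNC relative to $\Omega$ at $(\bar x,\bar y_1)$ and $(\bar x,\bar y_2)$, respectively. Then the sum $S_1+S_2$ is PSNC relative to $\Omega$ at $(\bar x,\bar y_1+\bar y_2)$.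
   Context: Hilbert spaces are identified with their duals; $\rightharpoonup$ is weak convergence; $X\times Y$ carries the norm $\sqrt{\|x\|^2+\|y\|^2}$. $\operatorname{gph}S=\{(x,y):y\in S(x)\}$; $S|_\Omega(x)=S(x)$ if $x\in\Omega$ and $\emptyset$ otherwise; $(S_1+S_2)(x)=S_1(x)+S_2(x)$ (Minkowski sum). A set is closed around one of its points $\bar u$ if its intersection with some closed set containing $\bar u$ in its interior is closed. Contingent cone at $\bar x\in\Omega$: $T(\bar x;\Omega)=\{z: \exists\, t_k\downarrow0,\ z_k\to z,\ \bar x+t_kz_k\in\Omega\}$. $\varepsilon$-normals at $\bar x\in\Omega$: $\widehat N_\varepsilon(\bar x;\Omega)=\{x^*: \limsup_{x\to\bar x,\,x\in\Omega}\langle x^*,x-\bar x\rangle/\|x-\bar x\|\le\varepsilon\}$. Relative mixed contingent coderivative (here the truncation set in $Y$ is all of $Y$ and, in Hilbert spaces, the duality mapping used in the general definition is the identity). For $S:X\rightrightarrows Y$ and $(\bar x,\bar y)\in\operatorname{gph}S|_\Omega$, $\bar x^*\in D_M^*S_\Omega(\bar x|\bar y)(\bar y^* )$ iff there are $\varepsilon_k\downarrow0$, $(x_k,y_k)\to(\bar x,\bar y)$ with $(x_k,y_k)\in\operatorname{gph}S|_\Omega$, $x_k^*\rightharpoonup\bar x^*$, and $y_k^*\to\bar y^*$ in norm such that $$(x_k^*,-y_k^* )\in\widehat N_{\varepsilon_k}\big((x_k,y_k);\operatorname{gph}S|_\Omega\big)\cap\big[T(x_k;\Omega)\times Y\big]\quad\text{for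 all }k.\qquad( * )$$ PSNC: $S$ is PSNC relative to $\Omega$ at $(\bar x,\bar y)\in\operatorname{gph}S|_\Omega$ if for all sequences $\varepsilon_k\in(0,1)$, $\varepsilon_k\downarrow0$, $\operatorname{gph}S|_\Omega\ni(x_k,y_k)\to(\bar x,\bar y)$, $(x_k^*,y_k^* )$ satisfying $( * )$ with $x_k^*\rightharpoonup0$, $y_k^*\to0$, one has $\|x_k^*\|\to0$. Inner semicontinuity: $F:U\rightrightarrows V$ is inner semicontinuous relative to $A\subset U$ at $(\bar u,\bar v)\in\operatorname{gph}F|_A$ if for every sequence $u_k\to\bar u$ with $u_k\in A$, $F(u_k)\ne\emptyset$, there are $v_k\in F(u_k)$ converging to $\bar v$. Here $F=G$, $U=X\times Y$, $A=\Omega\times Y$, $V=Y\times Y$. *)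

theory Defs
  imports "HOL-Analysis.Analysis"
begin

text \<open>
  Set-valued maps are functions into sets; their sum is the pointwise Minkowski sum, with \<open>+\<close> on
  sets from the library. Hilbert spaces are real and identified with their duals, so dual elements
  are vectors and the duality pairing is the inner product. The notation \<open>t\<^sub>k \<down> 0\<close> is read as
  \<open>t\<^sub>k > 0\<close> and \<open>t\<^sub>k \<longlonglongrightarrow> 0\<close>, without monotonicity. The normals, tangents and coderivatives below
  are only used at points of the respective sets.
\<close>

definition gph :: "('a \<Rightarrow> 'b set) \<Rightarrow> ('a \<times> 'b) set" where
  "gph S = {(x, y). y \<in> S x}"

definition restr :: "('a \<Rightarrow> 'b set) \<Rightarrow> 'a set \<Rightarrow> 'a \<Rightarrow> 'b set" where
  "restr S \<Omega> x = (if x \<in> \<Omega> then S x else {})"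

definition decreases_to_0 :: "(nat \<Rightarrow> real) \<Rightarrow> bool" where
  "decreases_to_0 t \<longleftrightarrow> (\<forall>k. t k > 0) \<and> t \<longlonglongrightarrow> 0"

definition weakly_converges :: "(nat \<Rightarrow> 'a::real_inner) \<Rightarrow> 'a \<Rightarrow> bool" where
  "weakly_converges x l \<longleftrightarrow> (\<forall>h. (\<lambda>k. x k \<bullet> h) \<longlonglongrightarrow> l \<bullet> h)"

definition closed_around :: "'a::topological_space set \<Rightarrow> 'a \<Rightarrow> bool" where
  "closed_around A u \<longleftrightarrow> u \<in> A \<and> (\<exists>C. closed C \<and> u \<in> interior C \<and> closed (A \<inter> C))"

definition contingent_cone :: "'a::real_normed_vector \<Rightarrow> 'a set \<Rightarrow> 'a set" where
  "contingent_cone xb \<Omega> =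
    {z. \<exists>t zs. decreases_to_0 t \<and> zs \<longlonglongrightarrow> z \<and> (\<forall>k. xb + t k *\<^sub>R zs k \<in> \<Omega>)}"

text \<open>
  The upper limit is taken over \<open>x \<noteq> xb\<close>, in the extended reals. At an isolated point of the
  set it is \<open>-\<infinity>\<close>, so that every vector is then an \<open>\<epsilon>\<close>-normal.
\<close>

definition eps_normals :: "real \<Rightarrow> 'a::real_inner \<Rightarrow> 'a set \<Rightarrow> 'a set" where
  "eps_normals \<epsilon> xb \<Omega> =
    {v. Limsup (at xb within \<Omega>) (\<lambda>x. ereal (v \<bullet> (x - xb) / norm (x - xb))) \<le> ereal \<epsilon>}"

definition tangential_normals ::
    "('a::real_inner \<Rightarrow> 'b::real_inner set) \<Rightarrow> 'a set \<Rightarrow> real \<Rightarrow> 'a \<times> 'b \<Rightarrow> ('a \<times> 'b) set" where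
  "tangential_normals S \<Omega> \<epsilon> p =
    eps_normals \<epsilon> p (gph (restr S \<Omega>)) \<inter> (contingent_cone (fst p) \<Omega> \<times> UNIV)"

text \<open>
  \<open>mixed_coderivative S \<Omega> (xb, yb) ybs\<close> is the relative mixed contingent coderivative
  \<open>D\<^sub>M\<^sup>*S\<^sub>\<Omega>(xb|yb)(ybs)\<close>.
\<close>

definition mixed_coderivative ::
    "('a::real_inner \<Rightarrow> 'b::real_inner set) \<Rightarrow> 'a set \<Rightarrow> 'a \<times> 'b \<Rightarrow> 'b \<Rightarrow> 'a set" where
  "mixed_coderivative S \<Omega> p ybs =
    {xbs. \<exists>\<epsilon> x y xs ys. decreases_to_0 \<epsilon> \<and>
       (\<forall>k. (x k, y k) \<in> gph (restr S \<Omega>)) \<and> (\<lambda>k. (x k, y k)) \<longlonglongrightarrow> p \<and>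
       weakly_converges xs xbs \<and> ys \<longlonglongrightarrow> ybs \<and>
       (\<forall>k. (xs k, - ys k) \<in> tangential_normals S \<Omega> (\<epsilon> k) (x k, y k))}"

text \<open>Partial sequential normal compactness relative to \<open>\<Omega>\<close>.\<close>

definition psnc ::
    "('a::real_inner \<Rightarrow> 'b::real_inner set) \<Rightarrow> 'a set \<Rightarrow> 'a \<times> 'b \<Rightarrow> bool" where
  "psnc S \<Omega> p \<longleftrightarrow> p \<in> gph (restr S \<Omega>) \<and>
    (\<forall>\<epsilon> x y xs ys.
       (\<forall>k. \<epsilon> k \<in> {0<..<1}) \<and> decreases_to_0 \<epsilon> \<and>
       (\<forall>k. (x k, y k) \<in> gph (restr S \<Omega>)) \<and> (\<lambda>k. (x k, y k)) \<longlonglongrightarrow> p \<and>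
       (\<forall>k. (xs k, - ys k) \<in> tangential_normals S \<Omega> (\<epsilon> k) (x k, y k)) \<and>
       weakly_converges xs 0 \<and> ys \<longlonglongrightarrow> 0
       \<longrightarrow> (\<lambda>k. norm (xs k)) \<longlonglongrightarrow> 0)"

definition inner_semicontinuous ::
    "('u::topological_space \<Rightarrow> 'v::topological_space set) \<Rightarrow> 'u set \<Rightarrow> 'u \<times> 'v \<Rightarrow> bool" where
  "inner_semicontinuous F A p \<longleftrightarrow> p \<in> gph (restr F A) \<and>
    (\<forall>u. u \<longlonglongrightarrow> fst p \<and> (\<forall>k. u k \<in> A \<and> F (u k) \<noteq> {})
       \<longrightarrow> (\<exists>v. (\<forall>k. v k \<in> F (u k)) \<and> v \<longlonglongrightarrow> snd p))"

definition sum_decomposition ::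
    "('a \<Rightarrow> 'b::plus set) \<Rightarrow> ('a \<Rightarrow> 'b set) \<Rightarrow> 'a \<times> 'b \<Rightarrow> ('b \<times> 'b) set" where
  "sum_decomposition S1 S2 = (\<lambda>(x, y). {(y1, y2). y1 \<in> S1 x \<and> y2 \<in> S2 x \<and> y1 + y2 = y})"

end

theory Submission
  imports Defs "HOL-Complex_Analysis.Great_Picard"
begin

text \<open>
  The heart of the proof is a fuzzy rule (\<open>relative_fuzzy_sum_rule\<close>) that splits a tangential
  \<open>\<epsilon>\<close>-normal \<open>(x\<^sup>*, -y\<^sup>*)\<close> to the graph of \<open>S\<^sub>1 + S\<^sub>2\<close> at \<open>(x, y\<^sub>1 + y\<^sub>2)\<close> into tangential normals
  to the graphs of the summands at points close to \<open>(x, y\<^sub>1)\<close> and \<open>(x, y\<^sub>2)\<close>. Up to an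
  arbitrarily small error, these have the form \<open>(\<theta> x\<^sup>* - a, -\<theta> y\<^sup>*)\<close> and \<open>(a, -\<theta> y\<^sup>*)\<close> with
  \<open>\<theta> \<ge> 0\<close> and \<open>|a|\<^sup>2 + \<theta>\<^sup>2 = 1\<close>; the multiplier \<open>\<theta>\<close> may vanish.

  To obtain them, one decouples the two summands: over \<open>(x\<^sub>1, v\<^sub>1)\<close> and \<open>(x\<^sub>2, v\<^sub>2)\<close> in the two graphs
  one minimizes, by Ekeland's variational principle, the norm of the pair formed by \<open>x\<^sub>1 - x\<^sub>2\<close> and
  the positive part of \<open>\<nu> - h\<close>, where \<open>\<nu> > 0\<close> is small and \<open>h\<close> is the function that the
  normality of \<open>(x\<^sup>*, -y\<^sup>*)\<close> makes nonpositive near the base point wherever \<open>x\<^sub>1 = x\<^sub>2\<close>. This norm is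
  then positive, and differentiable apart from the Lipschitz term \<open>\<epsilon> |.|\<close> in \<open>h\<close>, so that the
  first-order conditions in the two variables give the two normals, with \<open>(a, \<theta>)\<close> the normalized minimizing pair. The vector \<open>a\<close> is a
  positive multiple of \<open>x\<^sub>1 - x\<^sub>2\<close>; so for convex \<open>\<Omega>\<close> it is tangent to \<open>\<Omega>\<close> at \<open>x\<^sub>2\<close>, and \<open>-a\<close> is
  tangent at \<open>x\<^sub>1\<close>. The vector \<open>x\<^sup>*\<close>, which is tangent at \<open>x\<close>, is replaced by a nearby vector
  \<open>(z - x\<^sub>1) / \<tau>\<close> with \<open>z \<in> \<Omega>\<close>, which is tangent at \<open>x\<^sub>1\<close>.

  Now suppose that the \<open>x\<^sub>k\<^sup>*\<close> from the definition of PSNC for the sum do not converge to \<open>0\<close> in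
  norm. Inner semicontinuity provides decompositions of \<open>y\<^sub>k\<close> that converge to \<open>(y1b, y2b)\<close>, and
  the fuzzy rule provides \<open>a\<^sub>k\<close> and \<open>\<theta>\<^sub>k\<close>. A subsequence of the bounded sequence \<open>a\<^sub>k\<close> converges
  weakly to some \<open>l\<close> (\<open>bounded_imp_weakly_convergent_subsequence\<close>). Then \<open>-l\<close> and \<open>l\<close> lie in the
  coderivatives of \<open>S\<^sub>1\<close> and \<open>S\<^sub>2\<close> at \<open>0\<close>, and the qualification condition yields \<open>l = 0\<close>. PSNC of
  \<open>S\<^sub>2\<close> turns this into \<open>a\<^sub>k \<rightarrow> 0\<close> in norm, whence \<open>\<theta>\<^sub>k \<rightarrow> 1\<close>, and PSNC of \<open>S\<^sub>1\<close> gives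
  \<open>\<theta>\<^sub>k x\<^sub>k\<^sup>* - a\<^sub>k \<rightarrow> 0\<close>. Hence \<open>x\<^sub>k\<^sup>* \<rightarrow> 0\<close> along the subsequence, a contradiction.
\<close>

section \<open>Ekeland's variational principle\<close>

text \<open>
  In the iteration, \<open>u (n + 1)\<close> almost minimizes \<open>F\<close> over the set \<open>S (u n)\<close> of the points that
  improve on \<open>u n\<close> by at least \<open>\<kappa>\<close> times their distance from it. These sets are nested and their
  diameters tend to \<open>0\<close>; the minimizer is their common point.
\<close>

theorem ekeland_variational_principle:
  fixes F :: "'a::complete_space \<Rightarrow> real"
  assumes "closed C" and cont: "continuous_on C F" and nonneg: "\<And>w. w \<in> C \<Longrightarrow> F w \<ge> 0"
    and "w0 \<in> C" and "\<kappa> > 0"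
  obtains w where "w \<in> C" and "F w + \<kappa> * dist w w0 \<le> F w0"
    and "\<And>w'. w' \<in> C \<Longrightarrow> F w \<le> F w' + \<kappa> * dist w' w"
proof -
  define S where "S w = {w' \<in> C. F w' + \<kappa> * dist w' w \<le> F w}" for w
  have self: "w \<in> S w" if "w \<in> C" for w
    using that by (simp add: S_def)
  have S_mono: "S w' \<subseteq> S w" if "w' \<in> S w" for w w'
  proof
    fix v assume "v \<in> S w'"
    moreover have "\<kappa> * dist v w \<le> \<kappa> * dist v w' + \<kappa> * dist w' w"
      using \<open>\<kappa> > 0\<close> by (metis dist_triangle distrib_left mult_le_cancel_left_pos)
    ultimately show "v \<in> S w"
      using that by (auto simp: S_def)
  qed
  have closed_S: "closed (S w)" for w
  proof -
    have "continuous_on C (\<lambda>w'. F w' + \<kappa> * dist w' w)"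
      by (intro continuous_intros cont)
    then have "closed (C \<inter> (\<lambda>w'. F w' + \<kappa> * dist w' w) -` {..F w})"
      using \<open>closed C\<close> by (intro continuous_closed_preimage closed_atMost)
    moreover have "S w = C \<inter> (\<lambda>w'. F w' + \<kappa> * dist w' w) -` {..F w}"
      by (auto simp: S_def)
    ultimately show ?thesis by simp
  qed
  have step: "\<exists>w'. w' \<in> C \<and> w' \<in> S w \<and> (\<forall>v\<in>S w. F w' \<le> F v + 1 / Suc n)" if "w \<in> C" for w n
  proof -
    have ne: "F ` S w \<noteq> {}" and bdd: "bdd_below (F ` S w)"
      using self[OF that] nonneg by (auto simp: S_def intro!: bdd_belowI[of _ 0])
    have "Inf (F ` S w) < Inf (F ` S w) + 1 / Suc n" by simp
    then obtain w' where "w' \<in> S w" and w': "F w' < Inf (F ` S w) + 1 / Suc n"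
      using cInf_less_iff[OF ne bdd] by blast
    moreover have "F w' \<le> F v + 1 / Suc n" if "v \<in> S w" for v
      using cInf_lower[OF imageI[OF that] bdd] w' by simp
    ultimately show ?thesis by (auto simp: S_def)
  qed
  obtain u where u0: "u 0 \<in> C \<and> u 0 = w0"
    and u: "\<And>n. u (Suc n) \<in> C \<and> u (Suc n) \<in> S (u n) \<and> (\<forall>v\<in>S (u n). F (u (Suc n)) \<le> F v + 1 / Suc n)"
  proof (rule that)
    define u where "u = rec_nat w0 (\<lambda>n w. SOME w'. w' \<in> C \<and> w' \<in> S w \<and> (\<forall>v\<in>S w. F w' \<le> F v + 1 / Suc n))"
    have rec: "u (Suc n) = (SOME w'. w' \<in> C \<and> w' \<in> S (u n) \<and> (\<forall>v\<in>S (u n). F w' \<le> F v + 1 / Suc n))" for n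
      by (simp add: u_def)
    show "u 0 \<in> C \<and> u 0 = w0" using \<open>w0 \<in> C\<close> by (simp add: u_def)
    moreover have "u (Suc n) \<in> C" if "u n \<in> C" for n
      unfolding rec using someI_ex[OF step[OF that, of n]] by blast
    ultimately have "u n \<in> C" for n
      by (induction n) auto
    then show "u (Suc n) \<in> C \<and> u (Suc n) \<in> S (u n) \<and> (\<forall>v\<in>S (u n). F (u (Suc n)) \<le> F v + 1 / Suc n)" for n
      unfolding rec by (rule someI_ex[OF step])
  qed
  have uC: "u n \<in> C" for n
    using u0 u by (cases n) auto
  have small: "dist v (u (Suc n)) \<le> 1 / Suc n / \<kappa>" if "v \<in> S (u (Suc n))" for v n
  proof -
    have "v \<in> S (u n)" using that u[of n] S_mono by blast
    then have "F (u (Suc n)) \<le> F v + 1 / Suc n" using u[of n] by blast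
    moreover have "F v + \<kappa> * dist v (u (Suc n)) \<le> F (u (Suc n))" using that by (simp add: S_def)
    ultimately have "dist v (u (Suc n)) * \<kappa> \<le> 1 / Suc n" by (simp add: mult.commute)
    then show ?thesis using \<open>\<kappa> > 0\<close> by (simp only: pos_le_divide_eq)
  qed
  have lim: "(\<lambda>n. 1 / Suc n / \<kappa>) \<longlonglongrightarrow> 0"
    using tendsto_divide[OF LIMSEQ_inverse_real_of_nat tendsto_const, of \<kappa>] \<open>\<kappa> > 0\<close>
    by (simp add: inverse_eq_divide)
  obtain a where a: "\<And>n. a \<in> S (u n)"
  proof (rule decreasing_closed_nest[of "\<lambda>n. S (u n)"])
    show "closed (S (u n))" "S (u n) \<noteq> {}" for n
      using closed_S self[OF uC] by auto
    show "S (u n) \<subseteq> S (u m)" if "m \<le> n" for m n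
      using that by (rule lift_Suc_antimono_le[of "\<lambda>n. S (u n)", rotated]) (use u S_mono in blast)
    show "\<exists>n. \<forall>x\<in>S (u n). \<forall>y\<in>S (u n). dist x y < e" if "e > 0" for e
    proof -
      have "\<forall>\<^sub>F n in sequentially. 1 / Suc n / \<kappa> < e / 2"
        using order_tendstoD(2)[OF lim, of "e/2"] that by simp
      then obtain n where n: "1 / Suc n / \<kappa> < e / 2"
        by (auto simp: eventually_sequentially)
      have "dist x y < e" if "x \<in> S (u (Suc n))" "y \<in> S (u (Suc n))" for x y
        using small[OF that(1)] small[OF that(2)] n dist_triangle2[of x y "u (Suc n)"] by linarith
      then show ?thesis by blast
    qed
  qed (rule that)
  show thesis
  proof
    show "a \<in> C" "F a + \<kappa> * dist a w0 \<le> F w0"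
      using a[of 0] u0 by (auto simp: S_def)
    fix w' assume "w' \<in> C"
    show "F a \<le> F w' + \<kappa> * dist w' a"
    proof (rule ccontr)
      assume less: "\<not> ?thesis"
      \<comment> \<open>A violating point lies in all the sets \<open>S (u n)\<close>, hence coincides with \<open>a\<close>.\<close>
      then have "w' \<in> S a" using \<open>w' \<in> C\<close> by (simp add: S_def)
      then have *: "w' \<in> S (u n)" for n using a S_mono by blast
      have "dist w' a \<le> 1 / Suc n / \<kappa> + 1 / Suc n / \<kappa>" for n
        using small[OF *[of "Suc n"]] small[OF a[of "Suc n"]] dist_triangle2[of w' a "u (Suc n)"] by linarith
      moreover have "(\<lambda>n. 1 / Suc n / \<kappa> + 1 / Suc n / \<kappa>) \<longlonglongrightarrow> 0"
        using tendsto_add[OF lim lim] by simp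
      ultimately have "dist w' a \<le> 0"
        using LIMSEQ_le_const by blast
      then show False using less by simp
    qed
  qed
qed

section \<open>Weak sequential compactness in Hilbert spaces\<close>

lemma exists_orthogonal_projection:
  fixes M :: "'a::{real_inner, banach} set"
  assumes "closed M" and sub: "subspace M"
  obtains m where "m \<in> M" and "\<And>s. s \<in> M \<Longrightarrow> (h - m) \<bullet> s = 0"
proof -
  define d where "d = Inf ((\<lambda>m. (norm (h - m))\<^sup>2) ` M)"
  have ne: "(\<lambda>m. (norm (h - m))\<^sup>2) ` M \<noteq> {}"
    using subspace_0[OF sub] by blast
  have bdd: "bdd_below ((\<lambda>m. (norm (h - m))\<^sup>2) ` M)"
    by (intro bdd_belowI[of _ 0]) auto
  have d: "d \<le> (norm (h - m))\<^sup>2" if "m \<in> M" for m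
    unfolding d_def using bdd that by (intro cInf_lower) auto
  define S where "S n = {m \<in> M. (norm (h - m))\<^sup>2 \<le> d + 1 / Suc n}" for n :: nat
  obtain m where m: "\<And>n. m \<in> S n"
  proof (rule decreasing_closed_nest[of S])
    have "S n = M \<inter> {m. (norm (h - m))\<^sup>2 \<le> d + 1 / Suc n}" for n
      by (auto simp: S_def)
    then show "closed (S n)" for n
      using \<open>closed M\<close> by (simp only:) (intro closed_Int closed_Collect_le continuous_intros)
    show "S n \<noteq> {}" for n
    proof -
      have "Inf ((\<lambda>m. (norm (h - m))\<^sup>2) ` M) < d + 1 / Suc n" by (simp add: d_def)
      then obtain m where "m \<in> M" "(norm (h - m))\<^sup>2 < d + 1 / Suc n"
        unfolding cInf_less_iff[OF ne bdd] by blast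
      then show ?thesis
        unfolding S_def by (blast intro: less_imp_le)
    qed
    show "S n \<subseteq> S k" if "k \<le> n" for k n
    proof -
      have "1 / Suc n \<le> 1 / Suc k" using that by (simp add: field_simps)
      then show ?thesis by (auto simp: S_def intro: order_trans)
    qed
    show "\<exists>n. \<forall>x\<in>S n. \<forall>y\<in>S n. dist x y < e" if "e > 0" for e
    proof -
      obtain n where "inverse (real (Suc n)) < e\<^sup>2 / 4"
        using reals_Archimedean[of "e\<^sup>2 / 4"] \<open>e > 0\<close> by (auto simp del: of_nat_Suc)
      then have n: "4 * (1 / Suc n) < e\<^sup>2" by (simp add: inverse_eq_divide)
      have "dist x y < e" if "x \<in> S n" "y \<in> S n" for x y
      proof -
        \<comment> \<open>By the parallelogram identity, near-minimizers of the distance are close to each other.\<close>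
        have "(1/2) *\<^sub>R (x + y) \<in> M"
          using that sub by (auto simp: S_def intro: subspace_mul subspace_add)
        then have "d \<le> (norm (h - (1/2) *\<^sub>R (x + y)))\<^sup>2" by (rule d)
        moreover have "(norm (x - y))\<^sup>2 =
            2 * (norm (h - x))\<^sup>2 + 2 * (norm (h - y))\<^sup>2 - 4 * (norm (h - (1/2) *\<^sub>R (x + y)))\<^sup>2"
          unfolding power2_norm_eq_inner by (simp add: algebra_simps inner_commute)
        moreover have "(norm (h - x))\<^sup>2 \<le> d + 1 / Suc n" "(norm (h - y))\<^sup>2 \<le> d + 1 / Suc n"
          using that by (auto simp: S_def)
        ultimately have "(norm (x - y))\<^sup>2 \<le> 4 * (1 / Suc n)" by linarith
        then have "(dist x y)\<^sup>2 < e\<^sup>2" using n unfolding dist_norm by linarith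
        then show ?thesis using \<open>e > 0\<close> by (intro power2_less_imp_less[of _ e]) auto
      qed
      then show ?thesis by blast
    qed
  qed (rule that)
  have "m \<in> M" using m by (simp add: S_def)
  have "(norm (h - m))\<^sup>2 \<le> d"
  proof (rule LIMSEQ_le_const)
    show "(\<lambda>n. d + 1 / Suc n) \<longlonglongrightarrow> d"
      using tendsto_add[OF tendsto_const LIMSEQ_inverse_real_of_nat, of d]
      by (simp add: inverse_eq_divide)
  qed (use m in \<open>auto simp: S_def\<close>)
  then have min: "(norm (h - m))\<^sup>2 \<le> (norm (h - s))\<^sup>2" if "s \<in> M" for s
    using d[OF that] by linarith
  show thesis
  proof
    show "m \<in> M" by fact
    fix s assume "s \<in> M"
    show "(h - m) \<bullet> s = 0"
    proof (cases "s = 0")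
      case False
      \<comment> \<open>The step along \<open>s\<close> that minimizes the distance to \<open>h\<close>.\<close>
      define t where "t = ((h - m) \<bullet> s) / (s \<bullet> s)"
      have "m + t *\<^sub>R s \<in> M"
        using \<open>m \<in> M\<close> \<open>s \<in> M\<close> sub by (intro subspace_add subspace_mul)
      from min[OF this] have "0 \<le> - 2 * t * ((h - m) \<bullet> s) + t * t * (s \<bullet> s)"
        unfolding power2_norm_eq_inner by (simp add: algebra_simps inner_commute)
      moreover have "t * (s \<bullet> s) = (h - m) \<bullet> s" using False by (simp add: t_def)
      ultimately have "t * ((h - m) \<bullet> s) \<le> 0" by (simp add: mult.assoc)
      then have "((h - m) \<bullet> s)\<^sup>2 / (s \<bullet> s) \<le> 0" by (simp add: t_def power2_eq_square)
      moreover have "s \<bullet> s > 0" using False by simp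
      ultimately have "((h - m) \<bullet> s)\<^sup>2 \<le> 0" by (simp add: divide_le_0_iff)
      then show ?thesis by simp
    qed simp
  qed
qed

theorem riesz_representation:
  fixes f :: "'a::{real_inner, banach} \<Rightarrow> real"
  assumes "bounded_linear f"
  obtains e where "\<And>x. f x = e \<bullet> x"
proof (cases "\<forall>x. f x = 0")
  case True
  then show ?thesis using that[of 0] by simp
next
  case False
  interpret bounded_linear f by fact
  from False obtain h where "f h \<noteq> 0" by blast
  have "{x. f x = 0} = f -` {0}" by auto
  then have "closed {x. f x = 0}"
    by (simp add: closed_vimage continuous_on linear_continuous_on)
  moreover have "subspace {x. f x = 0}"
    by (auto simp: subspace_def add scale)
  ultimately obtain m where "m \<in> {x. f x = 0}" and "\<And>s. s \<in> {x. f x = 0} \<Longrightarrow> (h - m) \<bullet> s = 0"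
    using exists_orthogonal_projection[of "{x. f x = 0}" h] by blast
  then have "f m = 0" and m: "\<And>s. f s = 0 \<Longrightarrow> (h - m) \<bullet> s = 0"
    by simp_all
  define z where "z = h - m"
  have "f z \<noteq> 0" using \<open>f h \<noteq> 0\<close> \<open>f m = 0\<close> by (simp add: z_def diff)
  then have "z \<noteq> 0" by auto
  have "f x = ((f z / (z \<bullet> z)) *\<^sub>R z) \<bullet> x" for x
  proof -
    have "z \<bullet> (x - (f x / f z) *\<^sub>R z) = 0"
      unfolding z_def[symmetric] using m \<open>f z \<noteq> 0\<close> by (simp add: z_def[symmetric] diff scale)
    then have "z \<bullet> x = f x / f z * (z \<bullet> z)" by (simp add: inner_diff_right)
    then show ?thesis using \<open>f z \<noteq> 0\<close> \<open>z \<noteq> 0\<close> by (simp add: field_simps)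
  qed
  then show ?thesis by (rule that)
qed

text \<open>
  The space need not be separable. Diagonalization yields a subsequence whose inner products with
  every term of the sequence converge. The vectors \<open>x\<close> for which the inner products converge form
  a closed subspace \<open>V\<close>. It contains all terms, so the inner products with vectors orthogonal to \<open>V\<close>
  vanish, and \<open>V\<close> is the whole space. The limit functional is represented by the weak limit.
\<close>

theorem bounded_imp_weakly_convergent_subsequence:
  fixes b :: "nat \<Rightarrow> 'a::{real_inner, banach}"
  assumes bound: "\<And>n. norm (b n) \<le> B"
  obtains r l where "strict_mono r" and "weakly_converges (b \<circ> r) l"
proof -
  have "B \<ge> 0" using bound[of 0] norm_ge_zero order_trans by blast
  have inner_le: "norm (b n \<bullet> x) \<le> B * B" if "x \<in> range b" for n x
  proof -
    have "norm x \<le> B" using that bound by auto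
    then have "norm (b n) * norm x \<le> B * B"
      using bound \<open>B \<ge> 0\<close> by (intro mult_mono) auto
    then show ?thesis using Cauchy_Schwarz_ineq2[of "b n" x] by simp
  qed
  obtain r where "strict_mono r"
    and r: "\<And>x. x \<in> range b \<Longrightarrow> \<exists>l. (\<lambda>n. b (r n) \<bullet> x) \<longlonglongrightarrow> l"
    by (rule function_convergent_subsequence[of "range b" "\<lambda>n x. b n \<bullet> x" "B * B"])
      (simp, erule inner_le, blast)
  define V where "V = {x. convergent (\<lambda>n. b (r n) \<bullet> x)}"
  have sub: "subspace V"
    unfolding subspace_def V_def
    by (simp add: inner_add_right convergent_const convergent_add convergent_mult)
  have "closed V"
    unfolding closed_sequential_limits
  proof (intro allI impI, elim conjE)
    fix v x assume v: "\<forall>n. v n \<in> V" and "v \<longlonglongrightarrow> x"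
    have "Cauchy (\<lambda>n. b (r n) \<bullet> x)"
    proof (rule metric_CauchyI)
      fix e :: real assume "e > 0"
      define e' where "e' = e / (3 * (B + 1))"
      have "e' > 0" using \<open>e > 0\<close> \<open>B \<ge> 0\<close> by (simp add: e'_def)
      then obtain k where k: "norm (v k - x) < e'"
        using \<open>v \<longlonglongrightarrow> x\<close> by (metis LIMSEQ_iff order_refl)
      have close: "\<bar>b n \<bullet> v k - b n \<bullet> x\<bar> < e / 3" for n
      proof -
        have "\<bar>b n \<bullet> (v k - x)\<bar> \<le> norm (b n) * norm (v k - x)"
          by (rule Cauchy_Schwarz_ineq2)
        also have "\<dots> \<le> B * norm (v k - x)"
          by (intro mult_right_mono bound) simp
        also have "\<dots> \<le> B * e'" using k \<open>B \<ge> 0\<close> by (intro mult_left_mono) auto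
        also have "\<dots> < (B + 1) * e'" using \<open>e' > 0\<close> by (simp add: algebra_simps)
        also have "\<dots> = e / 3" using \<open>B \<ge> 0\<close> by (simp add: e'_def field_simps)
        finally show ?thesis by (simp add: inner_diff_right)
      qed
      have "Cauchy (\<lambda>n. b (r n) \<bullet> v k)"
        using v by (simp add: V_def Cauchy_convergent_iff)
      then obtain N where N: "\<And>m n. m \<ge> N \<Longrightarrow> n \<ge> N \<Longrightarrow> dist (b (r m) \<bullet> v k) (b (r n) \<bullet> v k) < e / 3"
        using \<open>e > 0\<close> metric_CauchyD[of _ "e / 3"] by (metis divide_pos_pos zero_less_numeral)
      have "dist (b (r m) \<bullet> x) (b (r n) \<bullet> x) < e" if "m \<ge> N" "n \<ge> N" for m n
        using N[OF that] close[of "r m"] close[of "r n"] unfolding dist_real_def by linarith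
      then show "\<exists>N. \<forall>m\<ge>N. \<forall>n\<ge>N. dist (b (r m) \<bullet> x) (b (r n) \<bullet> x) < e" by blast
    qed
    then show "x \<in> V" by (simp add: V_def Cauchy_convergent_iff)
  qed
  have "range b \<subseteq> V" using r by (auto simp: V_def convergent_def)
  have V_UNIV: "h \<in> V" for h
  proof -
    obtain m where "m \<in> V" and m: "\<And>s. s \<in> V \<Longrightarrow> (h - m) \<bullet> s = 0"
      using exists_orthogonal_projection[OF \<open>closed V\<close> sub] by blast
    have "b (r n) \<bullet> (h - m) = 0" for n
      using m[of "b (r n)"] \<open>range b \<subseteq> V\<close> by (auto simp: inner_commute)
    then have "b (r n) \<bullet> h = b (r n) \<bullet> m" for n by (simp add: inner_diff_right)
    then show ?thesis using \<open>m \<in> V\<close> by (simp add: V_def)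
  qed
  define f where "f h = lim (\<lambda>n. b (r n) \<bullet> h)" for h
  have f: "(\<lambda>n. b (r n) \<bullet> h) \<longlonglongrightarrow> f h" for h
    using V_UNIV[of h] by (simp add: V_def f_def convergent_LIMSEQ_iff)
  have "bounded_linear f"
  proof (rule bounded_linear_intro)
    show "f (x + y) = f x + f y" for x y
      using LIMSEQ_unique[OF f tendsto_add[OF f f, of x y, folded inner_add_right]] .
    show "f (c *\<^sub>R x) = c *\<^sub>R f x" for c x
      using LIMSEQ_unique[OF f[of "c *\<^sub>R x"]] tendsto_mult[OF tendsto_const f, of c x] by simp
    show "norm (f x) \<le> norm x * B" for x
    proof (rule LIMSEQ_le_const2[OF tendsto_norm[OF f]])
      have "norm (b (r n) \<bullet> x) \<le> norm x * B" for n
        using Cauchy_Schwarz_ineq2[of "b (r n)" x] mult_right_mono[OF bound[of "r n"], of "norm x"]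
        by (simp add: mult.commute)
      then show "\<exists>N. \<forall>n\<ge>N. norm (b (r n) \<bullet> x) \<le> norm x * B" by blast
    qed
  qed
  then obtain e where "\<And>x. f x = e \<bullet> x" using riesz_representation by blast
  then have "weakly_converges (b \<circ> r) e" using f by (simp add: weakly_converges_def)
  then show thesis using that \<open>strict_mono r\<close> by blast
qed

section \<open>Approximate normals and tangents\<close>

lemma eps_normals_iff:
  "v \<in> eps_normals \<epsilon> p A \<longleftrightarrow>
    (\<forall>\<delta>>0. \<exists>\<rho>>0. \<forall>q\<in>A. dist q p < \<rho> \<longrightarrow> v \<bullet> (q - p) \<le> (\<epsilon> + \<delta>) * norm (q - p))"
proof -
  have eq: "v \<bullet> (q - p) / norm (q - p) \<le> c \<longleftrightarrow> v \<bullet> (q - p) \<le> c * norm (q - p)" if "q \<noteq> p" for q c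
    using that by (simp add: pos_divide_le_eq)
  show ?thesis
  proof
    assume v: "v \<in> eps_normals \<epsilon> p A"
    show "\<forall>\<delta>>0. \<exists>\<rho>>0. \<forall>q\<in>A. dist q p < \<rho> \<longrightarrow> v \<bullet> (q - p) \<le> (\<epsilon> + \<delta>) * norm (q - p)"
    proof (intro allI impI)
      fix \<delta> :: real assume "\<delta> > 0"
      then have "ereal \<epsilon> < ereal (\<epsilon> + \<delta>)" by simp
      then have "\<forall>\<^sub>F q in at p within A. ereal (v \<bullet> (q - p) / norm (q - p)) < ereal (\<epsilon> + \<delta>)"
        using v unfolding eps_normals_def mem_Collect_eq Limsup_le_iff by blast
      then obtain \<rho> where "\<rho> > 0"
        and \<rho>: "\<And>q. q \<in> A \<Longrightarrow> q \<noteq> p \<Longrightarrow> dist q p < \<rho> \<Longrightarrow> v \<bullet> (q - p) / norm (q - p) < \<epsilon> + \<delta>"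
        unfolding eventually_at by auto
      have "v \<bullet> (q - p) \<le> (\<epsilon> + \<delta>) * norm (q - p)" if "q \<in> A" "dist q p < \<rho>" for q
        using \<rho>[OF that(1) _ that(2)] eq[of q "\<epsilon> + \<delta>"] by (cases "q = p") auto
      then show "\<exists>\<rho>>0. \<forall>q\<in>A. dist q p < \<rho> \<longrightarrow> v \<bullet> (q - p) \<le> (\<epsilon> + \<delta>) * norm (q - p)"
        using \<open>\<rho> > 0\<close> by blast
    qed
  next
    assume v: "\<forall>\<delta>>0. \<exists>\<rho>>0. \<forall>q\<in>A. dist q p < \<rho> \<longrightarrow> v \<bullet> (q - p) \<le> (\<epsilon> + \<delta>) * norm (q - p)"
    have "\<forall>\<^sub>F q in at p within A. ereal (v \<bullet> (q - p) / norm (q - p)) < y" if "ereal \<epsilon> < y" for y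
    proof -
      from ereal_dense2[OF that] obtain c where c: "ereal \<epsilon> < ereal c" "ereal c < y"
        by blast
      then obtain \<rho> where "\<rho> > 0"
        and \<rho>: "\<And>q. q \<in> A \<Longrightarrow> dist q p < \<rho> \<Longrightarrow> v \<bullet> (q - p) \<le> c * norm (q - p)"
        using v[rule_format, of "c - \<epsilon>"] by auto
      have "ereal (v \<bullet> (q - p) / norm (q - p)) < y" if "q \<in> A" "q \<noteq> p" "dist q p < \<rho>" for q
      proof -
        have "v \<bullet> (q - p) / norm (q - p) \<le> c"
          using \<rho>[OF that(1,3)] eq[OF that(2)] by blast
        then show ?thesis using c(2) le_less_trans ereal_less_eq(3) by blast
      qed
      then show ?thesis
        unfolding eventually_at using \<open>\<rho> > 0\<close> by blast
    qed
    then show "v \<in> eps_normals \<epsilon> p A"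
      unfolding eps_normals_def mem_Collect_eq Limsup_le_iff by blast
  qed
qed

lemma eps_normalsI_quadratic:
  assumes "\<rho> > 0" and "K \<ge> 0"
    and le: "\<And>q. q \<in> A \<Longrightarrow> dist q p < \<rho> \<Longrightarrow> v \<bullet> (q - p) \<le> \<epsilon> * norm (q - p) + K * (norm (q - p))\<^sup>2"
  shows "v \<in> eps_normals \<epsilon> p A"
  unfolding eps_normals_iff
proof (intro allI impI)
  fix \<delta> :: real assume "\<delta> > 0"
  define \<rho>' where "\<rho>' = min \<rho> (\<delta> / (K + 1))"
  have "\<rho>' > 0" using assms \<open>\<delta> > 0\<close> by (simp add: \<rho>'_def)
  moreover have "v \<bullet> (q - p) \<le> (\<epsilon> + \<delta>) * norm (q - p)" if "q \<in> A" "dist q p < \<rho>'" for q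
  proof -
    have "norm (q - p) \<le> \<delta> / (K + 1)" using that by (simp add: \<rho>'_def dist_norm)
    then have "(K + 1) * norm (q - p) \<le> \<delta>" using \<open>K \<ge> 0\<close> by (simp add: field_simps)
    then have "K * norm (q - p) \<le> \<delta>" using norm_ge_zero[of "q - p"] unfolding distrib_right by linarith
    from mult_right_mono[OF this norm_ge_zero[of "q - p"]]
    have "K * (norm (q - p))\<^sup>2 \<le> \<delta> * norm (q - p)" by (simp add: power2_eq_square mult.assoc)
    then show ?thesis using le[of q] that by (simp add: \<rho>'_def algebra_simps)
  qed
  ultimately show "\<exists>\<rho>>0. \<forall>q\<in>A. dist q p < \<rho> \<longrightarrow> v \<bullet> (q - p) \<le> (\<epsilon> + \<delta>) * norm (q - p)" by blast
qed

lemma eps_normals_perturb: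
  assumes "v \<in> eps_normals \<epsilon> p A" and "norm (v' - v) \<le> \<eta>"
  shows "v' \<in> eps_normals (\<epsilon> + \<eta>) p A"
  unfolding eps_normals_iff
proof (intro allI impI)
  fix \<delta> :: real assume "\<delta> > 0"
  then obtain \<rho> where "\<rho> > 0"
    and \<rho>: "\<And>q. q \<in> A \<Longrightarrow> dist q p < \<rho> \<Longrightarrow> v \<bullet> (q - p) \<le> (\<epsilon> + \<delta>) * norm (q - p)"
    using assms(1) unfolding eps_normals_iff by blast
  have "v' \<bullet> (q - p) \<le> (\<epsilon> + \<eta> + \<delta>) * norm (q - p)" if "q \<in> A" "dist q p < \<rho>" for q
  proof -
    have "(v' - v) \<bullet> (q - p) \<le> norm (v' - v) * norm (q - p)" by (rule norm_cauchy_schwarz)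
    also have "\<dots> \<le> \<eta> * norm (q - p)" using assms(2) by (intro mult_right_mono) auto
    finally show ?thesis using \<rho>[OF that] by (simp add: algebra_simps)
  qed
  then show "\<exists>\<rho>>0. \<forall>q\<in>A. dist q p < \<rho> \<longrightarrow> v' \<bullet> (q - p) \<le> (\<epsilon> + \<eta> + \<delta>) * norm (q - p)"
    using \<open>\<rho> > 0\<close> by blast
qed

lemma contingent_cone_convexI:
  fixes \<Omega> :: "'a::real_normed_vector set"
  assumes "convex \<Omega>" and "x \<in> \<Omega>" "p \<in> \<Omega>" "q \<in> \<Omega>" and "\<alpha> \<ge> 0" "\<beta> \<ge> 0"
  shows "\<alpha> *\<^sub>R (p - x) + \<beta> *\<^sub>R (q - x) \<in> contingent_cone x \<Omega>"
proof -
  \<comment> \<open>The factor makes \<open>x\<close> plus \<open>t n\<close> times the direction a convex combination of \<open>x\<close>, \<open>p\<close>, \<open>q\<close>.\<close>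
  define t where "t n = 1 / (\<alpha> + \<beta> + 1) * (1 / Suc n)" for n :: nat
  have "t n > 0" for n using assms by (simp add: t_def add_nonneg_pos)
  moreover have "t \<longlonglongrightarrow> 1 / (\<alpha> + \<beta> + 1) * 0"
    unfolding t_def using LIMSEQ_inverse_real_of_nat
    by (intro tendsto_mult tendsto_const) (simp add: inverse_eq_divide)
  ultimately have "decreases_to_0 t" by (simp add: decreases_to_0_def)
  moreover have "x + t n *\<^sub>R (\<alpha> *\<^sub>R (p - x) + \<beta> *\<^sub>R (q - x)) \<in> \<Omega>" for n
  proof -
    have "t n \<le> 1 / (\<alpha> + \<beta> + 1) * 1"
      unfolding t_def using assms by (intro mult_left_mono) auto
    then have "t n * (\<alpha> + \<beta> + 1) \<le> 1" using assms by (simp add: pos_le_divide_eq add_nonneg_pos)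
    then have "t n * \<alpha> + t n * \<beta> \<le> 1" using \<open>t n > 0\<close> by (simp add: algebra_simps)
    then have "(1 - t n * \<alpha> - t n * \<beta>) *\<^sub>R x + (t n * \<alpha>) *\<^sub>R p + (t n * \<beta>) *\<^sub>R q \<in> convex hull {x, p, q}"
      unfolding convex_hull_3 using assms \<open>t n > 0\<close>
      by (intro CollectI exI[of _ "1 - t n * \<alpha> - t n * \<beta>"] exI[of _ "t n * \<alpha>"] exI[of _ "t n * \<beta>"]) auto
    also have "\<dots> \<subseteq> \<Omega>" using assms by (intro hull_minimal) auto
    finally have "(1 - t n * \<alpha> - t n * \<beta>) *\<^sub>R x + (t n * \<alpha>) *\<^sub>R p + (t n * \<beta>) *\<^sub>R q \<in> \<Omega>" .
    then show ?thesis by (simp add: algebra_simps)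
  qed
  ultimately show ?thesis
    unfolding contingent_cone_def
    by (auto intro!: exI[of _ t] exI[of _ "\<lambda>_. \<alpha> *\<^sub>R (p - x) + \<beta> *\<^sub>R (q - x)"])
qed

text \<open>
  A second-order upper estimate for the norm of \<open>(u, max 0 s)\<close>, which is differentiable in \<open>(u, s)\<close>
  wherever it is positive. It follows from \<open>2 \<Phi> \<Psi> \<le> \<Phi>\<^sup>2 + \<Psi>\<^sup>2\<close> for the old value \<open>\<Phi>\<close> and the new
  value \<open>\<Psi>\<close>.
\<close>

lemma truncated_norm_growth:
  fixes u d :: "'a::real_inner" and s e :: real
  defines "\<Phi> \<equiv> sqrt ((norm u)\<^sup>2 + (max 0 s)\<^sup>2)"
  assumes "\<Phi> > 0"
  shows "sqrt ((norm (u + d))\<^sup>2 + (max 0 (s + e))\<^sup>2)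
    \<le> \<Phi> + (u \<bullet> d + max 0 s * e) / \<Phi> + ((norm d)\<^sup>2 + e\<^sup>2) / (2 * \<Phi>)"
proof -
  define \<Psi> where "\<Psi> = sqrt ((norm (u + d))\<^sup>2 + (max 0 (s + e))\<^sup>2)"
  have "(max 0 (s + e))\<^sup>2 \<le> (max 0 s + e)\<^sup>2"
  proof (cases "s + e \<le> 0")
    case False
    then show ?thesis by (intro power_mono) auto
  qed (simp add: max_absorb1)
  moreover have "(norm (u + d))\<^sup>2 = (norm u)\<^sup>2 + 2 * (u \<bullet> d) + (norm d)\<^sup>2"
    unfolding power2_norm_eq_inner by (simp add: algebra_simps inner_commute)
  moreover have "(max 0 s + e)\<^sup>2 = (max 0 s)\<^sup>2 + 2 * (max 0 s * e) + e\<^sup>2"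
    by (simp add: power2_sum)
  moreover have "\<Phi>\<^sup>2 = (norm u)\<^sup>2 + (max 0 s)\<^sup>2" "\<Psi>\<^sup>2 = (norm (u + d))\<^sup>2 + (max 0 (s + e))\<^sup>2"
    by (simp_all add: \<Phi>_def \<Psi>_def)
  ultimately have "\<Psi>\<^sup>2 \<le> \<Phi>\<^sup>2 + 2 * (u \<bullet> d + max 0 s * e) + ((norm d)\<^sup>2 + e\<^sup>2)"
    by (simp add: algebra_simps)
  moreover have "2 * \<Phi> * \<Psi> \<le> \<Psi>\<^sup>2 + \<Phi>\<^sup>2"
    using sum_squares_bound[of \<Phi> \<Psi>] by simp
  ultimately have "2 * \<Phi> * \<Psi> \<le> 2 * \<Phi>\<^sup>2 + 2 * (u \<bullet> d + max 0 s * e) + ((norm d)\<^sup>2 + e\<^sup>2)"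
    by linarith
  also have "\<dots> = 2 * \<Phi> * (\<Phi> + (u \<bullet> d + max 0 s * e) / \<Phi> + ((norm d)\<^sup>2 + e\<^sup>2) / (2 * \<Phi>))"
    using \<open>\<Phi> > 0\<close> unfolding distrib_left power2_eq_square[of \<Phi>] by simp
  finally have "2 * \<Phi> * \<Psi> \<le> 2 * \<Phi> * (\<Phi> + (u \<bullet> d + max 0 s * e) / \<Phi> + ((norm d)\<^sup>2 + e\<^sup>2) / (2 * \<Phi>))" .
  then show ?thesis
    unfolding \<Psi>_def[symmetric] by (rule mult_left_le_imp_le) (use \<open>\<Phi> > 0\<close> in simp)
qed

section \<open>Fuzzy decomposition of normals\<close>

text \<open>
  The assumption \<open>normal\<close> says that \<open>(xs, -ys, -ys)\<close> is, near the base point, an \<open>\<epsilon>\<close>-normal to the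
  set of all \<open>(u, v1, v2)\<close> with \<open>(u, v1) \<in> A1\<close> and \<open>(u, v2) \<in> A2\<close>, the error being measured by the
  change of \<open>u\<close> and of \<open>v1 + v2\<close> alone.
\<close>

theorem fuzzy_intersection_rule:
  fixes A1 A2 :: "('a::{real_inner, banach} \<times> 'b::{real_inner, banach}) set"
  assumes base: "(x, y1) \<in> A1" "(x, y2) \<in> A2"
    and C1: "(x, y1) \<in> interior C1" "closed (A1 \<inter> C1)"
    and C2: "(x, y2) \<in> interior C2" "closed (A2 \<inter> C2)"
    and "\<rho> > 0" and normal: "\<And>u v1 v2. (u, v1) \<in> A1 \<Longrightarrow> (u, v2) \<in> A2 \<Longrightarrow>
        dist (u, v1) (x, y1) < \<rho> \<Longrightarrow> dist (u, v2) (x, y2) < \<rho> \<Longrightarrow>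
        xs \<bullet> (u - x) - ys \<bullet> (v1 + v2 - (y1 + y2)) \<le> \<epsilon> * norm (u - x, v1 + v2 - (y1 + y2))"
    and "\<epsilon> \<ge> 0" and "\<eta> > 0"
  obtains x1 v1 x2 v2 and \<theta> \<Phi> :: real
  where "(x1, v1) \<in> A1" "(x2, v2) \<in> A2"
    and "dist (x1, v1) (x, y1) \<le> \<eta>" "dist (x2, v2) (x, y2) \<le> \<eta>"
    and "\<Phi> > 0" "\<theta> \<ge> 0" and "(norm ((1 / \<Phi>) *\<^sub>R (x1 - x2)))\<^sup>2 + \<theta>\<^sup>2 = 1"
    and "(\<theta> *\<^sub>R xs - (1 / \<Phi>) *\<^sub>R (x1 - x2), - (\<theta> *\<^sub>R ys)) \<in> eps_normals (\<epsilon> + \<eta>) (x1, v1) A1"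
    and "((1 / \<Phi>) *\<^sub>R (x1 - x2), - (\<theta> *\<^sub>R ys)) \<in> eps_normals (\<epsilon> + \<eta>) (x2, v2) A2"
proof -
  obtain r1 r2 where r12: "r1 > 0" "cball (x, y1) r1 \<subseteq> C1" "r2 > 0" "cball (x, y2) r2 \<subseteq> C2"
    using C1(1) C2(1) unfolding mem_interior_cball by blast
  define r where "r = Min {\<rho> / 2, r1, r2}"
  have r: "r > 0" "r < \<rho>" "r \<le> r1" "r \<le> r2"
    using r12 \<open>\<rho> > 0\<close> by (auto simp: r_def)
  define D1 where "D1 = A1 \<inter> cball (x, y1) r"
  define D2 where "D2 = A2 \<inter> cball (x, y2) r"
  have D1_eq: "D1 = (A1 \<inter> C1) \<inter> cball (x, y1) r"
    using r12(2) subset_cball[OF r(3), of "(x, y1)"] by (auto simp: D1_def)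
  have D2_eq: "D2 = (A2 \<inter> C2) \<inter> cball (x, y2) r"
    using r12(4) subset_cball[OF r(4), of "(x, y2)"] by (auto simp: D2_def)
  have closed_D: "closed (D1 \<times> D2)"
    unfolding D1_eq D2_eq using C1(2) C2(2) by (intro closed_Times closed_Int[OF _ closed_cball])
  define g where "g w = (fst (fst w) - x, snd (fst w) + snd (snd w) - (y1 + y2))" for w :: "('a \<times> 'b) \<times> ('a \<times> 'b)"
  define h where "h w = xs \<bullet> fst (g w) - ys \<bullet> snd (g w) - \<epsilon> * norm (g w)" for w
  \<comment> \<open>The starting value of \<open>\<Phi>\<close> is \<open>\<kappa>\<^sup>2\<close>, so that the approximate minimizer with Ekeland slope
    \<open>\<kappa>\<close> is within distance \<open>\<kappa>\<close> of the starting point.\<close>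
  define \<kappa> where "\<kappa> = min \<eta> r / 2"
  have \<kappa>: "\<kappa> > 0" "\<kappa> \<le> \<eta>" "\<kappa> < r" using r \<open>\<eta> > 0\<close> by (auto simp: \<kappa>_def)
  define s where "s w = \<kappa>\<^sup>2 - h w" for w
  define \<Phi> where "\<Phi> w = sqrt ((norm (fst (fst w) - fst (snd w)))\<^sup>2 + (max 0 (s w))\<^sup>2)" for w
  define w0 where "w0 = ((x, y1), (x, y2))"
  have "w0 \<in> D1 \<times> D2" using base r by (simp add: w0_def D1_def D2_def)
  have \<Phi>_nonneg: "\<Phi> w \<ge> 0" for w by (simp add: \<Phi>_def)
  have "continuous_on (D1 \<times> D2) \<Phi>"
    unfolding \<Phi>_def s_def h_def g_def by (intro continuous_intros)
  then obtain w where wD: "w \<in> D1 \<times> D2" and w_near: "\<Phi> w + \<kappa> * dist w w0 \<le> \<Phi> w0"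
    and w_min: "\<And>w'. w' \<in> D1 \<times> D2 \<Longrightarrow> \<Phi> w \<le> \<Phi> w' + \<kappa> * dist w' w"
    using ekeland_variational_principle[OF closed_D _ _ \<open>w0 \<in> D1 \<times> D2\<close> \<kappa>(1), of \<Phi>] \<Phi>_nonneg
    by blast
  obtain x1 v1 x2 v2 where w: "w = ((x1, v1), (x2, v2))" by (metis surj_pair)
  have "\<Phi> w0 = sqrt ((\<kappa>\<^sup>2)\<^sup>2)"
    by (simp add: \<Phi>_def s_def h_def g_def w0_def norm_Pair)
  also have "\<dots> = \<kappa>\<^sup>2" by (simp only: real_sqrt_abs abs_power2)
  finally have "\<kappa> * dist w w0 \<le> \<kappa> * \<kappa>"
    using w_near \<Phi>_nonneg[of w] by (simp add: power2_eq_square)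
  then have "dist w w0 \<le> \<kappa>" using \<kappa> by simp
  then have near: "dist (x1, v1) (x, y1) \<le> \<kappa>" "dist (x2, v2) (x, y2) \<le> \<kappa>"
    using dist_fst_le[of w w0] dist_snd_le[of w w0] by (simp_all add: w w0_def)
  have in_A: "(x1, v1) \<in> A1" "(x2, v2) \<in> A2" using wD by (auto simp: w D1_def D2_def)
  \<comment> \<open>If \<open>x1 = x2\<close>, then \<open>h w \<le> 0\<close> by normality, and the second component of the pair is positive.\<close>
  have \<Phi>_pos: "\<Phi> w > 0"
  proof (cases "x1 = x2")
    case True
    have "h w \<le> 0"
      using normal[of x1 v1 v2] in_A near \<kappa> r by (simp add: True h_def g_def w)
    then have "s w > 0" using zero_less_power[OF \<kappa>(1), of 2] unfolding s_def by linarith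
    then show ?thesis by (simp add: \<Phi>_def add_nonneg_pos)
  next
    case False
    then show ?thesis by (simp add: \<Phi>_def w add_pos_nonneg)
  qed
  define a where "a = (1 / \<Phi> w) *\<^sub>R (x1 - x2)"
  define \<theta> where "\<theta> = max 0 (s w) / \<Phi> w"
  have \<Phi>_sq: "(\<Phi> w)\<^sup>2 = (norm (x1 - x2))\<^sup>2 + (max 0 (s w))\<^sup>2"
    by (simp add: \<Phi>_def w)
  have unit: "(norm a)\<^sup>2 + \<theta>\<^sup>2 = 1"
  proof -
    have "(norm a)\<^sup>2 = (norm (x1 - x2))\<^sup>2 / (\<Phi> w)\<^sup>2" "\<theta>\<^sup>2 = (max 0 (s w))\<^sup>2 / (\<Phi> w)\<^sup>2"
      by (simp_all add: a_def \<theta>_def power_divide)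
    then have "(norm a)\<^sup>2 + \<theta>\<^sup>2 = (\<Phi> w)\<^sup>2 / (\<Phi> w)\<^sup>2"
      by (simp only: \<Phi>_sq add_divide_distrib)
    then show ?thesis using \<Phi>_pos by simp
  qed
  have "\<theta> \<ge> 0" using \<Phi>_pos by (simp add: \<theta>_def)
  have "\<theta>\<^sup>2 \<le> 1\<^sup>2" using unit by (metis le_add_same_cancel2 one_power2 zero_le_power2)
  then have "\<theta> \<le> 1" by (rule power2_le_imp_le) simp
  define M where "M = norm xs + norm ys + \<epsilon>"
  have "M \<ge> 0" using \<open>\<epsilon> \<ge> 0\<close> by (simp add: M_def)
  define K where "K = (1 + M\<^sup>2) / (2 * \<Phi> w)"
  have "K \<ge> 0" using \<Phi>_pos by (simp add: K_def)
  \<comment> \<open>First-order condition at the minimizer \<open>w\<close> for a feasible \<open>w'\<close> that moves \<open>x1 - x2\<close> by \<open>dx\<close>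
    and \<open>g\<close> by \<open>(gx, gy)\<close>. It is used with only one of the two graph points moved.\<close>
  have first_order: "- (a \<bullet> dx) + \<theta> * (xs \<bullet> gx - ys \<bullet> gy) \<le> (\<epsilon> + \<eta>) * m + K * m\<^sup>2"
    if w': "w' \<in> D1 \<times> D2" and dx: "fst (fst w') - fst (snd w') = (x1 - x2) + dx"
      and g': "g w' = g w + (gx, gy)" and m: "dist w' w = m" "norm dx \<le> m" "norm (gx, gy) \<le> m"
    for w' dx gx gy m
  proof -
    have "m \<ge> 0" using m(1) by auto
    have xy: "norm gx \<le> m" "norm gy \<le> m"
      using norm_fst_le[of gx gy] norm_snd_le[of gy gx] m(3) by auto
    define e where "e = s w' - s w"
    have e_eq: "e = - (xs \<bullet> gx - ys \<bullet> gy) + \<epsilon> * (norm (g w') - norm (g w))"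
      by (simp add: e_def s_def h_def g' inner_add_right algebra_simps)
    have "\<bar>norm (g w') - norm (g w)\<bar> \<le> m"
      using norm_triangle_ineq3[of "g w'" "g w"] m(3) by (simp add: g')
    then have \<epsilon>_part: "\<bar>\<epsilon> * (norm (g w') - norm (g w))\<bar> \<le> \<epsilon> * m"
      using \<open>\<epsilon> \<ge> 0\<close> by (simp add: abs_mult mult_left_mono)
    have "\<bar>xs \<bullet> gx\<bar> \<le> norm xs * m" "\<bar>ys \<bullet> gy\<bar> \<le> norm ys * m"
      using Cauchy_Schwarz_ineq2[of xs gx] Cauchy_Schwarz_ineq2[of ys gy]
        mult_left_mono[OF xy(1), of "norm xs"] mult_left_mono[OF xy(2), of "norm ys"] by auto
    then have "\<bar>e\<bar> \<le> M * m"
      using \<epsilon>_part unfolding e_eq M_def distrib_right by linarith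
    then have "e\<^sup>2 \<le> (M * m)\<^sup>2" using abs_le_square_iff[of e "M * m"] by simp
    moreover have "(norm dx)\<^sup>2 \<le> m\<^sup>2" using m(2) by (intro power_mono) auto
    ultimately have "(norm dx)\<^sup>2 + e\<^sup>2 \<le> (1 + M\<^sup>2) * m\<^sup>2"
      by (simp add: power_mult_distrib distrib_right)
    then have "((norm dx)\<^sup>2 + e\<^sup>2) / (2 * \<Phi> w) \<le> (1 + M\<^sup>2) * m\<^sup>2 / (2 * \<Phi> w)"
      using \<Phi>_pos by (intro divide_right_mono) auto
    then have rem: "((norm dx)\<^sup>2 + e\<^sup>2) / (2 * \<Phi> w) \<le> K * m\<^sup>2"
      by (simp add: K_def)
    have "\<Phi> w' = sqrt ((norm ((x1 - x2) + dx))\<^sup>2 + (max 0 (s w + e))\<^sup>2)"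
      by (simp add: \<Phi>_def dx e_def)
    also have "\<dots> \<le> \<Phi> w + ((x1 - x2) \<bullet> dx + max 0 (s w) * e) / \<Phi> w + ((norm dx)\<^sup>2 + e\<^sup>2) / (2 * \<Phi> w)"
      using truncated_norm_growth[of "x1 - x2" "s w" dx e] \<Phi>_pos by (simp add: \<Phi>_def w)
    also have "((x1 - x2) \<bullet> dx + max 0 (s w) * e) / \<Phi> w = a \<bullet> dx + \<theta> * e"
      by (simp add: a_def \<theta>_def add_divide_distrib)
    finally have "\<Phi> w' \<le> \<Phi> w + (a \<bullet> dx + \<theta> * e) + K * m\<^sup>2" using rem by linarith
    then have "0 \<le> \<kappa> * m + (a \<bullet> dx + \<theta> * e) + K * m\<^sup>2"
      using w_min[OF w', unfolded m(1)] by linarith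
    moreover have "\<theta> * e \<le> - (\<theta> * (xs \<bullet> gx - ys \<bullet> gy)) + \<epsilon> * m"
    proof -
      have "\<theta> * (\<epsilon> * (norm (g w') - norm (g w))) \<le> \<theta> * (\<epsilon> * m)"
        by (rule mult_left_mono[OF _ \<open>\<theta> \<ge> 0\<close>]) (use \<epsilon>_part in linarith)
      also have "\<dots> \<le> 1 * (\<epsilon> * m)"
        using \<open>\<theta> \<le> 1\<close> \<open>\<epsilon> \<ge> 0\<close> \<open>m \<ge> 0\<close> by (intro mult_right_mono) auto
      finally have "\<theta> * (\<epsilon> * (norm (g w') - norm (g w))) \<le> \<epsilon> * m" by simp
      then show ?thesis
        by (simp only: e_eq distrib_left mult_minus_right add_le_cancel_left)
    qed
    moreover have "\<kappa> * m \<le> \<eta> * m" using \<kappa> \<open>m \<ge> 0\<close> by (intro mult_right_mono)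
    ultimately show ?thesis unfolding distrib_right by linarith
  qed
  have D1_near: "q \<in> D1" if "q \<in> A1" "dist q (x1, v1) < r - \<kappa>" for q
    using that near(1) dist_triangle[of q "(x, y1)" "(x1, v1)"] by (simp add: D1_def dist_commute)
  have D2_near: "q \<in> D2" if "q \<in> A2" "dist q (x2, v2) < r - \<kappa>" for q
    using that near(2) dist_triangle[of q "(x, y2)" "(x2, v2)"] by (simp add: D2_def dist_commute)
  have "(\<theta> *\<^sub>R xs - a, - (\<theta> *\<^sub>R ys)) \<in> eps_normals (\<epsilon> + \<eta>) (x1, v1) A1"
  proof (rule eps_normalsI_quadratic)
    show "r - \<kappa> > 0" "K \<ge> 0" using \<kappa> \<open>K \<ge> 0\<close> by auto
    fix q assume q: "q \<in> A1" "dist q (x1, v1) < r - \<kappa>"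
    obtain u v where uv: "q = (u, v)" by (metis surj_pair)
    have "- (a \<bullet> (u - x1)) + \<theta> * (xs \<bullet> (u - x1) - ys \<bullet> (v - v1))
        \<le> (\<epsilon> + \<eta>) * norm (q - (x1, v1)) + K * (norm (q - (x1, v1)))\<^sup>2"
    proof (rule first_order[of "(q, (x2, v2))"])
      show "(q, (x2, v2)) \<in> D1 \<times> D2" using D1_near[OF q] wD by (simp add: w)
      show "dist (q, (x2, v2)) w = norm (q - (x1, v1))" by (simp add: w dist_Pair_Pair dist_norm)
      show "norm (u - x1) \<le> norm (q - (x1, v1))"
        using norm_fst_le[of "u - x1" "v - v1"] by (simp add: uv)
    qed (simp_all add: uv g_def w)
    then show "(\<theta> *\<^sub>R xs - a, - (\<theta> *\<^sub>R ys)) \<bullet> (q - (x1, v1))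
        \<le> (\<epsilon> + \<eta>) * norm (q - (x1, v1)) + K * (norm (q - (x1, v1)))\<^sup>2"
      by (simp add: uv inner_diff_left algebra_simps)
  qed
  moreover have "(a, - (\<theta> *\<^sub>R ys)) \<in> eps_normals (\<epsilon> + \<eta>) (x2, v2) A2"
  proof (rule eps_normalsI_quadratic)
    show "r - \<kappa> > 0" "K \<ge> 0" using \<kappa> \<open>K \<ge> 0\<close> by auto
    fix q assume q: "q \<in> A2" "dist q (x2, v2) < r - \<kappa>"
    obtain u v where uv: "q = (u, v)" by (metis surj_pair)
    have "- (a \<bullet> - (u - x2)) + \<theta> * (xs \<bullet> 0 - ys \<bullet> (v - v2))
        \<le> (\<epsilon> + \<eta>) * norm (q - (x2, v2)) + K * (norm (q - (x2, v2)))\<^sup>2"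
    proof (rule first_order[of "((x1, v1), q)"])
      show "((x1, v1), q) \<in> D1 \<times> D2" using D2_near[OF q] wD by (simp add: w)
      show "dist ((x1, v1), q) w = norm (q - (x2, v2))" by (simp add: w dist_Pair_Pair dist_norm)
      show "norm (- (u - x2)) \<le> norm (q - (x2, v2))"
        using norm_fst_le[of "u - x2" "v - v2"] by (simp add: uv norm_minus_commute)
      show "norm (0::'a, v - v2) \<le> norm (q - (x2, v2))"
        using norm_snd_le[of "v - v2" "u - x2"] by (simp add: uv norm_Pair)
    qed (simp_all add: uv g_def w)
    then show "(a, - (\<theta> *\<^sub>R ys)) \<bullet> (q - (x2, v2))
        \<le> (\<epsilon> + \<eta>) * norm (q - (x2, v2)) + K * (norm (q - (x2, v2)))\<^sup>2"
      by (simp add: uv algebra_simps)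
  qed
  ultimately show thesis
    using that[of x1 v1 x2 v2 "\<Phi> w" \<theta>] in_A near \<kappa> \<Phi>_pos \<open>\<theta> \<ge> 0\<close> unit by (simp add: a_def)
qed

text \<open>
  The tangency to \<open>\<Omega>\<close> of the first components is where convexity enters. The vector \<open>xs'\<close> is the
  replacement of \<open>xs\<close> that is tangent at the point of \<open>\<Omega>\<close> underlying \<open>p1\<close>.
\<close>

theorem relative_fuzzy_sum_rule:
  fixes S1 S2 :: "'a::{real_inner, banach} \<Rightarrow> 'b::{real_inner, banach} set"
  assumes "convex \<Omega>" and base: "(x, y1) \<in> gph (restr S1 \<Omega>)" "(x, y2) \<in> gph (restr S2 \<Omega>)"
    and C1: "(x, y1) \<in> interior C1" "closed (gph (restr S1 \<Omega>) \<inter> C1)"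
    and C2: "(x, y2) \<in> interior C2" "closed (gph (restr S2 \<Omega>) \<inter> C2)"
    and normal: "(xs, - ys) \<in> tangential_normals (\<lambda>x. S1 x + S2 x) \<Omega> \<epsilon> (x, y1 + y2)"
    and "\<epsilon> \<ge> 0" and "\<eta> > 0"
  obtains p1 p2 \<theta> a xs'
  where "p1 \<in> gph (restr S1 \<Omega>)" "p2 \<in> gph (restr S2 \<Omega>)"
    and "dist p1 (x, y1) \<le> \<eta>" "dist p2 (x, y2) \<le> \<eta>" and "norm (xs' - xs) \<le> \<eta>"
    and "\<theta> \<ge> 0" and "(norm a)\<^sup>2 + \<theta>\<^sup>2 = 1"
    and "(\<theta> *\<^sub>R xs' - a, - (\<theta> *\<^sub>R ys)) \<in> tangential_normals S1 \<Omega> (\<epsilon> + \<eta>) p1"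
    and "(a, - (\<theta> *\<^sub>R ys)) \<in> tangential_normals S2 \<Omega> (\<epsilon> + \<eta>) p2"
proof -
  have xs_normal: "(xs, - ys) \<in> eps_normals \<epsilon> (x, y1 + y2) (gph (restr (\<lambda>x. S1 x + S2 x) \<Omega>))"
    and xs_tangent: "xs \<in> contingent_cone x \<Omega>"
    using normal by (auto simp: tangential_normals_def)
  obtain t zs where t: "\<And>k. t k > 0" and zs: "zs \<longlonglongrightarrow> xs" "\<And>k. x + t k *\<^sub>R zs k \<in> \<Omega>"
    using xs_tangent by (auto simp: contingent_cone_def decreases_to_0_def)
  obtain j where j: "norm (zs j - xs) < \<eta> / 4"
    using LIMSEQ_D[OF zs(1), of "\<eta> / 4"] \<open>\<eta> > 0\<close> by auto
  define \<tau> where "\<tau> = t j"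
  define z where "z = x + \<tau> *\<^sub>R zs j"
  have "\<tau> > 0" "z \<in> \<Omega>" using t zs(2) by (simp_all add: \<tau>_def z_def)
  \<comment> \<open>The step \<open>\<tau>\<close> is fixed before the radius \<open>\<eta>'\<close>: moving the base point \<open>x\<close> to \<open>x1\<close> changes
    the difference quotient of \<open>z\<close> by \<open>norm (x - x1) / \<tau>\<close>, which the bound \<open>\<eta> / 4 * \<tau>\<close> keeps small.\<close>
  define \<eta>' where "\<eta>' = min (\<eta> / 4) (\<eta> / 4 * \<tau>)"
  have \<eta>': "\<eta>' > 0" "\<eta>' \<le> \<eta> / 4" "\<eta>' \<le> \<eta> / 4 * \<tau>" using \<open>\<eta> > 0\<close> \<open>\<tau> > 0\<close> by (auto simp: \<eta>'_def)
  obtain \<rho> where "\<rho> > 0" and \<rho>: "\<And>q. q \<in> gph (restr (\<lambda>x. S1 x + S2 x) \<Omega>) \<Longrightarrow> dist q (x, y1 + y2) < \<rho> \<Longrightarrow>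
      (xs, - ys) \<bullet> (q - (x, y1 + y2)) \<le> (\<epsilon> + \<eta> / 4) * norm (q - (x, y1 + y2))"
    using xs_normal[unfolded eps_normals_iff, rule_format, of "\<eta> / 4"] \<open>\<eta> > 0\<close> by auto
  have local_normal: "xs \<bullet> (u - x) - ys \<bullet> (v1 + v2 - (y1 + y2)) \<le> (\<epsilon> + \<eta> / 4) * norm (u - x, v1 + v2 - (y1 + y2))"
    if "(u, v1) \<in> gph (restr S1 \<Omega>)" "(u, v2) \<in> gph (restr S2 \<Omega>)"
      and d: "dist (u, v1) (x, y1) < \<rho> / 2" "dist (u, v2) (x, y2) < \<rho> / 2" for u v1 v2
  proof -
    have "(u, v1 + v2) \<in> gph (restr (\<lambda>x. S1 x + S2 x) \<Omega>)"
      using that(1,2) by (auto simp: gph_def restr_def split: if_splits)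
    moreover have "dist (u, v1 + v2) (x, y1 + y2) < \<rho>"
    proof -
      have "dist (u, v1 + v2) (x, y1 + y2) = norm ((u - x, v1 - y1) + (0, v2 - y2))"
        by (simp add: dist_norm algebra_simps)
      also have "\<dots> \<le> norm (u - x, v1 - y1) + norm (v2 - y2)"
        using norm_triangle_ineq[of "(u - x, v1 - y1)" "(0, v2 - y2)"] by (simp add: norm_Pair)
      also have "\<dots> \<le> dist (u, v1) (x, y1) + dist (u, v2) (x, y2)"
        using norm_snd_le[of "v2 - y2" "u - x"] by (simp add: dist_norm)
      finally show ?thesis using d by linarith
    qed
    ultimately show ?thesis using \<rho>[of "(u, v1 + v2)"] by (simp add: algebra_simps)
  qed
  have half_\<rho>: "\<rho> / 2 > 0" and \<epsilon>_\<eta>: "\<epsilon> + \<eta> / 4 \<ge> 0"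
    using \<open>\<rho> > 0\<close> \<open>\<epsilon> \<ge> 0\<close> \<open>\<eta> > 0\<close> by auto
  obtain x1 v1 x2 v2 \<theta> \<Phi>
    where mem: "(x1, v1) \<in> gph (restr S1 \<Omega>)" "(x2, v2) \<in> gph (restr S2 \<Omega>)"
      and dist: "dist (x1, v1) (x, y1) \<le> \<eta>'" "dist (x2, v2) (x, y2) \<le> \<eta>'"
      and pos: "\<Phi> > 0" "\<theta> \<ge> 0" and unit: "(norm ((1 / \<Phi>) *\<^sub>R (x1 - x2)))\<^sup>2 + \<theta>\<^sup>2 = 1"
      and n1: "(\<theta> *\<^sub>R xs - (1 / \<Phi>) *\<^sub>R (x1 - x2), - (\<theta> *\<^sub>R ys))
          \<in> eps_normals (\<epsilon> + \<eta> / 4 + \<eta>') (x1, v1) (gph (restr S1 \<Omega>))"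
      and n2: "((1 / \<Phi>) *\<^sub>R (x1 - x2), - (\<theta> *\<^sub>R ys))
          \<in> eps_normals (\<epsilon> + \<eta> / 4 + \<eta>') (x2, v2) (gph (restr S2 \<Omega>))"
    by (rule fuzzy_intersection_rule[OF base C1 C2 half_\<rho> local_normal \<epsilon>_\<eta> \<eta>'(1)])
  define a where "a = (1 / \<Phi>) *\<^sub>R (x1 - x2)"
  define xs' where "xs' = (1 / \<tau>) *\<^sub>R (z - x1)"
  have in_\<Omega>: "x1 \<in> \<Omega>" "x2 \<in> \<Omega>" using mem by (auto simp: gph_def restr_def split: if_splits)
  have "norm (x - x1) \<le> \<eta> / 4 * \<tau>"
    using dist(1) \<eta>'(3) dist_fst_le[of "(x1, v1)" "(x, y1)"] by (simp add: dist_norm norm_minus_commute)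
  then have "norm ((1 / \<tau>) *\<^sub>R (x - x1)) \<le> \<eta> / 4"
    using \<open>\<tau> > 0\<close> by (simp only: norm_scaleR) (simp add: field_simps)
  moreover have "xs' - xs = (zs j - xs) + (1 / \<tau>) *\<^sub>R (x - x1)"
    using \<open>\<tau> > 0\<close> by (simp add: xs'_def z_def algebra_simps)
  then have "norm (xs' - xs) \<le> norm (zs j - xs) + norm ((1 / \<tau>) *\<^sub>R (x - x1))"
    by (simp only: norm_triangle_ineq)
  ultimately have xs'_near: "norm (xs' - xs) \<le> \<eta> / 2"
    using j by linarith
  have "\<theta>\<^sup>2 \<le> 1\<^sup>2" using unit by (metis le_add_same_cancel2 one_power2 zero_le_power2)
  then have "\<theta> \<le> 1" by (rule power2_le_imp_le) simp
  have \<epsilon>_sum: "\<epsilon> + \<eta> / 4 + \<eta>' + (3 * \<eta> / 4 - \<eta>') = \<epsilon> + \<eta>" by simp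
  have "norm ((\<theta> *\<^sub>R xs' - a, - (\<theta> *\<^sub>R ys)) - (\<theta> *\<^sub>R xs - a, - (\<theta> *\<^sub>R ys))) = \<theta> * norm (xs' - xs)"
    using pos by (simp add: norm_Pair scaleR_diff_right[symmetric])
  also have "\<dots> \<le> 1 * (\<eta> / 2)" using xs'_near \<open>\<theta> \<le> 1\<close> by (intro mult_mono) auto
  also have "\<dots> \<le> 3 * \<eta> / 4 - \<eta>'" using \<eta>' by simp
  finally have N1: "(\<theta> *\<^sub>R xs' - a, - (\<theta> *\<^sub>R ys)) \<in> eps_normals (\<epsilon> + \<eta>) (x1, v1) (gph (restr S1 \<Omega>))"
    by (rule eps_normals_perturb[OF n1[folded a_def], of _ "3 * \<eta> / 4 - \<eta>'", unfolded \<epsilon>_sum])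
  have N2: "(a, - (\<theta> *\<^sub>R ys)) \<in> eps_normals (\<epsilon> + \<eta>) (x2, v2) (gph (restr S2 \<Omega>))"
    using eps_normals_perturb[OF n2[folded a_def], of "(a, - (\<theta> *\<^sub>R ys))" "3 * \<eta> / 4 - \<eta>'"] \<eta>' \<open>\<eta> > 0\<close>
    unfolding \<epsilon>_sum by simp
  have "(1 / \<Phi>) *\<^sub>R (x2 - x1) + (\<theta> / \<tau>) *\<^sub>R (z - x1) \<in> contingent_cone x1 \<Omega>"
    using pos \<open>\<tau> > 0\<close> by (intro contingent_cone_convexI \<open>convex \<Omega>\<close> in_\<Omega> \<open>z \<in> \<Omega>\<close>) auto
  then have "\<theta> *\<^sub>R xs' - a \<in> contingent_cone x1 \<Omega>"
    by (simp add: a_def xs'_def algebra_simps)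
  moreover have "(1 / \<Phi>) *\<^sub>R (x1 - x2) + 0 *\<^sub>R (x1 - x2) \<in> contingent_cone x2 \<Omega>"
    using pos by (intro contingent_cone_convexI \<open>convex \<Omega>\<close> in_\<Omega>) auto
  ultimately have "(\<theta> *\<^sub>R xs' - a, - (\<theta> *\<^sub>R ys)) \<in> tangential_normals S1 \<Omega> (\<epsilon> + \<eta>) (x1, v1)"
    and "(a, - (\<theta> *\<^sub>R ys)) \<in> tangential_normals S2 \<Omega> (\<epsilon> + \<eta>) (x2, v2)"
    using N1 N2 by (simp_all add: tangential_normals_def a_def)
  moreover have "dist (x1, v1) (x, y1) \<le> \<eta>" "dist (x2, v2) (x, y2) \<le> \<eta>" "norm (xs' - xs) \<le> \<eta>"
    using dist xs'_near \<eta>' \<open>\<eta> > 0\<close> by linarith+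
  ultimately show thesis
    using mem pos unit unfolding a_def[symmetric] by (intro that)
qed

section \<open>Subsequences and null sequences\<close>

lemma not_tendsto_0_subsequence:
  fixes f :: "nat \<Rightarrow> 'a::real_normed_vector"
  assumes "\<not> f \<longlonglongrightarrow> 0" and "eventually Q sequentially"
  obtains \<delta> and r :: "nat \<Rightarrow> nat" where "\<delta> > 0" "strict_mono r" "\<And>k. norm (f (r k)) \<ge> \<delta>" "\<And>k. Q (r k)"
proof -
  obtain \<delta> where "\<delta> > 0" and "\<not> eventually (\<lambda>k. norm (f k) < \<delta>) sequentially"
    using assms(1) unfolding tendsto_iff by (auto simp: dist_norm)
  then have "frequently (\<lambda>k. norm (f k) \<ge> \<delta>) sequentially"
    by (simp add: frequently_def not_le)
  moreover have "eventually (\<lambda>k. norm (f k) \<ge> \<delta> \<longrightarrow> norm (f k) \<ge> \<delta> \<and> Q k) sequentially"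
    using assms(2) by eventually_elim simp
  ultimately have "frequently (\<lambda>k. norm (f k) \<ge> \<delta> \<and> Q k) sequentially"
    by (rule frequently_rev_mp)
  then have "infinite {k. norm (f k) \<ge> \<delta> \<and> Q k}"
    unfolding cofinite_eq_sequentially[symmetric] frequently_cofinite .
  then obtain r :: "nat \<Rightarrow> nat" where "strict_mono r" "\<And>k. r k \<in> {k. norm (f k) \<ge> \<delta> \<and> Q k}"
    using infinite_enumerate by blast
  then show thesis using that \<open>\<delta> > 0\<close> by blast
qed

lemma bounded_scaleR_tendsto_0:
  fixes f :: "nat \<Rightarrow> 'a::real_normed_vector"
  assumes "f \<longlonglongrightarrow> 0" and "\<And>k. \<bar>c k\<bar> \<le> (B::real)"
  shows "(\<lambda>k. c k *\<^sub>R f k) \<longlonglongrightarrow> 0"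
proof (rule tendsto_0_le[OF assms(1), of _ B])
  show "\<forall>\<^sub>F k in sequentially. norm (c k *\<^sub>R f k) \<le> norm (f k) * B"
    by (simp add: mult.commute[of _ B] mult_right_mono assms(2))
qed

lemma tendsto_of_dist_le:
  assumes "f \<longlonglongrightarrow> l" and "\<And>k. dist (g k) (f k) \<le> e k" and "e \<longlonglongrightarrow> 0"
  shows "g \<longlonglongrightarrow> l"
proof (rule metric_tendsto_imp_tendsto)
  show "(\<lambda>k. dist (f k) l + e k) \<longlonglongrightarrow> 0"
    using tendsto_add[OF iffD1[OF tendsto_dist_iff assms(1)] assms(3)] by simp
  have "dist (g k) l \<le> dist (dist (f k) l + e k) 0" for k
    using assms(2)[of k] dist_triangle[of "g k" l "f k"] by (simp add: dist_real_def)
  then show "\<forall>\<^sub>F k in sequentially. dist (g k) l \<le> dist (dist (f k) l + e k) 0" by simp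
qed

section \<open>PSNC of sums\<close>

theorem proposition4p11:
  fixes S1 S2 :: "'a::{real_inner, banach} \<Rightarrow> 'b::{real_inner, banach} set"
    and \<Omega> :: "'a set" and xb :: 'a and yb y1b y2b :: 'b
  assumes "closed \<Omega>" and "convex \<Omega>"
    and "(xb, yb) \<in> gph (restr (\<lambda>x. S1 x + S2 x) \<Omega>)"
    and "(y1b, y2b) \<in> sum_decomposition S1 S2 (xb, yb)"
    and "inner_semicontinuous (sum_decomposition S1 S2) (\<Omega> \<times> UNIV) ((xb, yb), (y1b, y2b))"
    and "closed_around (gph (restr S1 \<Omega>)) (xb, y1b)"
    and "closed_around (gph (restr S2 \<Omega>)) (xb, y2b)"
    and "mixed_coderivative S1 \<Omega> (xb, y1b) 0 \<inter> uminus ` mixed_coderivative S2 \<Omega> (xb, y2b) 0 = {0}"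
    and "psnc S1 \<Omega> (xb, y1b)"
    and "psnc S2 \<Omega> (xb, y2b)"
  shows "psnc (\<lambda>x. S1 x + S2 x) \<Omega> (xb, y1b + y2b)"
  unfolding psnc_def
proof (intro conjI allI impI; (elim conjE)?)
  have yb: "yb = y1b + y2b" using assms(4) by (simp add: sum_decomposition_def)
  then show "(xb, y1b + y2b) \<in> gph (restr (\<lambda>x. S1 x + S2 x) \<Omega>)" using assms(3) by simp
  fix \<epsilon> x y xs ys
  assume \<epsilon>: "\<forall>k. \<epsilon> k \<in> {0<..<1}" "decreases_to_0 \<epsilon>"
    and xy: "\<forall>k. (x k, y k) \<in> gph (restr (\<lambda>x. S1 x + S2 x) \<Omega>)"
      "(\<lambda>k. (x k, y k)) \<longlonglongrightarrow> (xb, y1b + y2b)"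
    and normal: "\<forall>k. (xs k, - ys k) \<in> tangential_normals (\<lambda>x. S1 x + S2 x) \<Omega> (\<epsilon> k) (x k, y k)"
    and xs: "weakly_converges xs 0" and ys: "ys \<longlonglongrightarrow> 0"
  have in_\<Omega>: "x k \<in> \<Omega>" and sum: "y k \<in> S1 (x k) + S2 (x k)" for k
    using xy(1)[rule_format, of k] by (auto simp: gph_def restr_def split: if_splits)
  have "sum_decomposition S1 S2 (x k, y k) \<noteq> {}" for k
  proof -
    obtain v1 v2 where "v1 \<in> S1 (x k)" "v2 \<in> S2 (x k)" "y k = v1 + v2"
      using sum[of k] by (rule set_plus_elim)
    then have "(v1, v2) \<in> sum_decomposition S1 S2 (x k, y k)"
      by (simp add: sum_decomposition_def)
    then show ?thesis by blast
  qed
  then have "\<exists>v. (\<forall>k. v k \<in> sum_decomposition S1 S2 (x k, y k)) \<and> v \<longlonglongrightarrow> (y1b, y2b)"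
    using assms(5)[unfolded inner_semicontinuous_def yb, THEN conjunct2, THEN spec[of _ "\<lambda>k. (x k, y k)"]]
      xy(2) in_\<Omega> by simp
  then obtain v where v: "\<And>k. v k \<in> sum_decomposition S1 S2 (x k, y k)" "v \<longlonglongrightarrow> (y1b, y2b)"
    by blast
  define y1 where "y1 k = fst (v k)" for k
  define y2 where "y2 k = snd (v k)" for k
  have y_sum: "y k = y1 k + y2 k" and mem: "(x k, y1 k) \<in> gph (restr S1 \<Omega>)" "(x k, y2 k) \<in> gph (restr S2 \<Omega>)" for k
    using v(1)[of k] in_\<Omega>[of k] by (auto simp: sum_decomposition_def y1_def y2_def gph_def restr_def)
  have "x \<longlonglongrightarrow> xb" using tendsto_fst[OF xy(2)] by simp
  have lim1: "(\<lambda>k. (x k, y1 k)) \<longlonglongrightarrow> (xb, y1b)" and lim2: "(\<lambda>k. (x k, y2 k)) \<longlonglongrightarrow> (xb, y2b)"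
    using tendsto_Pair[OF \<open>x \<longlonglongrightarrow> xb\<close> tendsto_fst[OF v(2)]] tendsto_Pair[OF \<open>x \<longlonglongrightarrow> xb\<close> tendsto_snd[OF v(2)]]
    by (simp_all add: y1_def y2_def)
  obtain C1 where C1: "(xb, y1b) \<in> interior C1" "closed (gph (restr S1 \<Omega>) \<inter> C1)"
    using assms(6) by (auto simp: closed_around_def)
  obtain C2 where C2: "(xb, y2b) \<in> interior C2" "closed (gph (restr S2 \<Omega>) \<inter> C2)"
    using assms(7) by (auto simp: closed_around_def)
  define \<gamma> where "\<gamma> k = \<epsilon> k + 1 / Suc k" for k
  have inv: "(\<lambda>k. 1 / Suc k) \<longlonglongrightarrow> 0"
    using LIMSEQ_inverse_real_of_nat by (simp add: inverse_eq_divide)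
  have \<gamma>_pos: "\<gamma> k > 0" for k using \<epsilon>(1) by (simp add: \<gamma>_def add_pos_pos)
  have \<gamma>_lim: "\<gamma> \<longlonglongrightarrow> 0"
    using tendsto_add[OF \<epsilon>(2)[unfolded decreases_to_0_def, THEN conjunct2] inv]
    by (simp add: \<gamma>_def[abs_def])
  \<comment> \<open>What the fuzzy rule and PSNC require of an index; it holds for all large indices.\<close>
  define Q where "Q k \<longleftrightarrow> (x k, y1 k) \<in> interior C1 \<and> (x k, y2 k) \<in> interior C2 \<and> \<gamma> k < 1" for k
  have ev: "eventually Q sequentially"
    unfolding Q_def using C1(1) C2(1)
    by (intro eventually_conj topological_tendstoD[OF lim1] topological_tendstoD[OF lim2]
        order_tendstoD(2)[OF \<gamma>_lim]) auto
  have "xs \<longlonglongrightarrow> 0"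
  proof (rule ccontr)
    assume "\<not> xs \<longlonglongrightarrow> 0"
    then obtain \<delta> and r :: "nat \<Rightarrow> nat" where "\<delta> > 0" and r: "strict_mono r" and \<delta>: "\<And>k. norm (xs (r k)) \<ge> \<delta>"
      and Q: "\<And>k. Q (r k)"
      using not_tendsto_0_subsequence[OF _ ev] by blast
    \<comment> \<open>The conclusion of the fuzzy rule at the index \<open>r k\<close> with radius \<open>1 / Suc (r k)\<close>.\<close>
    define R where "R k p1 p2 \<theta> a xs' \<longleftrightarrow>
        p1 \<in> gph (restr S1 \<Omega>) \<and> p2 \<in> gph (restr S2 \<Omega>) \<and>
        dist p1 (x (r k), y1 (r k)) \<le> 1 / Suc (r k) \<and> dist p2 (x (r k), y2 (r k)) \<le> 1 / Suc (r k) \<and>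
        norm (xs' - xs (r k)) \<le> 1 / Suc (r k) \<and> \<theta> \<ge> 0 \<and> (norm a)\<^sup>2 + \<theta>\<^sup>2 = 1 \<and>
        (\<theta> *\<^sub>R xs' - a, - (\<theta> *\<^sub>R ys (r k))) \<in> tangential_normals S1 \<Omega> (\<gamma> (r k)) p1 \<and>
        (a, - (\<theta> *\<^sub>R ys (r k))) \<in> tangential_normals S2 \<Omega> (\<gamma> (r k)) p2"
      for k p1 p2 \<theta> a xs'
    have "\<exists>p1 p2 \<theta> a xs'. R k p1 p2 \<theta> a xs'" for k
    proof -
      have "(x (r k), y1 (r k)) \<in> interior C1" "(x (r k), y2 (r k)) \<in> interior C2"
        "\<epsilon> (r k) \<ge> 0" "1 / real (Suc (r k)) > 0"
        "(xs (r k), - ys (r k)) \<in> tangential_normals (\<lambda>x. S1 x + S2 x) \<Omega> (\<epsilon> (r k)) (x (r k), y1 (r k) + y2 (r k))"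
        using Q[of k] normal[rule_format, of "r k"] \<epsilon>(1)[rule_format, of "r k"]
        unfolding Q_def y_sum by auto
      note rule = relative_fuzzy_sum_rule[OF \<open>convex \<Omega>\<close> mem[of "r k"] this(1) C1(2) this(2) C2(2)
          this(5,3,4), folded \<gamma>_def]
      show ?thesis
        by (rule rule, intro exI, unfold R_def, intro conjI)
    qed
    then obtain p1 p2 \<theta> a xs' where R: "\<And>k. R k (p1 k) (p2 k) (\<theta> k) (a k) (xs' k)"
      by metis
    have "norm (a k) \<le> 1" for k
    proof -
      have "(norm (a k))\<^sup>2 + (\<theta> k)\<^sup>2 = 1" using R[of k] by (simp add: R_def)
      then have "(norm (a k))\<^sup>2 \<le> 1\<^sup>2" by (metis le_add_same_cancel1 one_power2 zero_le_power2)
      then show ?thesis by (rule power2_le_imp_le) simp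
    qed
    then obtain s l where s: "strict_mono s" and l: "weakly_converges (a \<circ> s) l"
      by (rule bounded_imp_weakly_convergent_subsequence)
    define q where "q = r \<circ> s"
    have q: "strict_mono q" using r s by (simp add: q_def strict_mono_o)
    define \<mu> where "\<mu> k = \<theta> (s k)" for k
    define b where "b k = a (s k)" for k
    define w where "w k = xs' (s k)" for k
    define P1 where "P1 k = p1 (s k)" for k
    define P2 where "P2 k = p2 (s k)" for k
    have P_mem: "P1 k \<in> gph (restr S1 \<Omega>)" "P2 k \<in> gph (restr S2 \<Omega>)"
      and P_dist: "dist (P1 k) (x (q k), y1 (q k)) \<le> 1 / Suc (q k)" "dist (P2 k) (x (q k), y2 (q k)) \<le> 1 / Suc (q k)"
      and w_near: "norm (w k - xs (q k)) \<le> 1 / Suc (q k)"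
      and \<mu>: "\<mu> k \<ge> 0" "(norm (b k))\<^sup>2 + (\<mu> k)\<^sup>2 = 1"
      and N1: "(\<mu> k *\<^sub>R w k - b k, - (\<mu> k *\<^sub>R ys (q k))) \<in> tangential_normals S1 \<Omega> (\<gamma> (q k)) (P1 k)"
      and N2: "(b k, - (\<mu> k *\<^sub>R ys (q k))) \<in> tangential_normals S2 \<Omega> (\<gamma> (q k)) (P2 k)" for k
      using R[of "s k"] unfolding R_def by (simp_all add: q_def \<mu>_def b_def w_def P1_def P2_def)
    note subseq = LIMSEQ_subseq_LIMSEQ[OF _ q, unfolded o_def]
    have \<gamma>_dec: "decreases_to_0 (\<lambda>k. \<gamma> (q k))" and \<gamma>_1: "\<forall>k. \<gamma> (q k) \<in> {0<..<1}"
      using \<gamma>_pos subseq[OF \<gamma>_lim] Q by (auto simp: decreases_to_0_def Q_def q_def)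
    have P1_lim: "P1 \<longlonglongrightarrow> (xb, y1b)" and P2_lim: "P2 \<longlonglongrightarrow> (xb, y2b)"
      using tendsto_of_dist_le[OF subseq[OF lim1] P_dist(1) subseq[OF inv]]
        tendsto_of_dist_le[OF subseq[OF lim2] P_dist(2) subseq[OF inv]] by auto
    have \<mu>_le: "\<bar>\<mu> k\<bar> \<le> 1" for k
    proof -
      have "(\<mu> k)\<^sup>2 \<le> 1\<^sup>2" using \<mu>(2)[of k] by (metis le_add_same_cancel2 one_power2 zero_le_power2)
      then show ?thesis by (simp add: abs_square_le_1)
    qed
    have ys_lim: "(\<lambda>k. \<mu> k *\<^sub>R ys (q k)) \<longlonglongrightarrow> 0"
      by (intro bounded_scaleR_tendsto_0[OF subseq[OF ys] \<mu>_le])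
    have diff_lim: "(\<lambda>k. w k - xs (q k)) \<longlonglongrightarrow> 0"
      by (rule tendsto_0_le[OF subseq[OF inv], of _ 1]) (use w_near in auto)
    \<comment> \<open>\<open>xs\<close> is only perturbed by a norm-null sequence and scaled by a bounded one.\<close>
    have w_weak: "(\<lambda>k. (\<mu> k *\<^sub>R w k) \<bullet> h) \<longlonglongrightarrow> 0" for h
    proof -
      have "(\<lambda>k. xs (q k) \<bullet> h) \<longlonglongrightarrow> 0 \<bullet> h"
        using xs unfolding weakly_converges_def by (intro subseq[of "\<lambda>k. xs k \<bullet> h"]) blast
      from tendsto_add[OF tendsto_inner[OF diff_lim tendsto_const[of h]] this]
      have "(\<lambda>k. (w k - xs (q k)) \<bullet> h + xs (q k) \<bullet> h) \<longlonglongrightarrow> 0 \<bullet> h + 0 \<bullet> h" .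
      then have "(\<lambda>k. w k \<bullet> h) \<longlonglongrightarrow> 0" by (simp add: inner_diff_left)
      from bounded_scaleR_tendsto_0[OF this \<mu>_le] show ?thesis by simp
    qed
    have b_weak: "weakly_converges b l" using l by (simp add: b_def weakly_converges_def)
    have c_weak: "weakly_converges (\<lambda>k. \<mu> k *\<^sub>R w k - b k) (- l)"
      unfolding weakly_converges_def
    proof
      fix h
      show "(\<lambda>k. (\<mu> k *\<^sub>R w k - b k) \<bullet> h) \<longlonglongrightarrow> - l \<bullet> h"
        using tendsto_diff[OF w_weak[of h] b_weak[unfolded weakly_converges_def, rule_format, of h]]
        by (simp add: inner_diff_left)
    qed
    have coderivativeI: "u0 \<in> mixed_coderivative S \<Omega> p 0"
      if "\<And>k. P k \<in> gph (restr S \<Omega>)" "P \<longlonglongrightarrow> p" "weakly_converges u u0"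
        "\<And>k. (u k, - (\<mu> k *\<^sub>R ys (q k))) \<in> tangential_normals S \<Omega> (\<gamma> (q k)) (P k)"
      for S :: "'a \<Rightarrow> 'b set" and p P u u0
      unfolding mixed_coderivative_def mem_Collect_eq
      using that \<gamma>_dec ys_lim
      by (intro exI[of _ "\<lambda>k. \<gamma> (q k)"] exI[of _ "\<lambda>k. fst (P k)"] exI[of _ "\<lambda>k. snd (P k)"]
          exI[of _ u] exI[of _ "\<lambda>k. \<mu> k *\<^sub>R ys (q k)"] conjI allI) simp_all
    have "- l \<in> mixed_coderivative S1 \<Omega> (xb, y1b) 0"
      by (rule coderivativeI[OF P_mem(1) P1_lim c_weak N1])
    moreover have "l \<in> mixed_coderivative S2 \<Omega> (xb, y2b) 0"
      by (rule coderivativeI[OF P_mem(2) P2_lim b_weak N2])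
    ultimately have "- l \<in> {0}" using assms(8) by blast
    then have "l = 0" by simp
    have psncD: "(\<lambda>k. norm (u k)) \<longlonglongrightarrow> 0"
      if "psnc S \<Omega> p" "\<And>k. P k \<in> gph (restr S \<Omega>)" "P \<longlonglongrightarrow> p" "weakly_converges u 0"
        "\<And>k. (u k, - (\<mu> k *\<^sub>R ys (q k))) \<in> tangential_normals S \<Omega> (\<gamma> (q k)) (P k)"
      for S :: "'a \<Rightarrow> 'b set" and p P u
    proof (rule that(1)[unfolded psnc_def, THEN conjunct2, THEN spec[of _ "\<lambda>k. \<gamma> (q k)"],
          THEN spec[of _ "\<lambda>k. fst (P k)"], THEN spec[of _ "\<lambda>k. snd (P k)"], THEN spec[of _ u],
          THEN spec[of _ "\<lambda>k. \<mu> k *\<^sub>R ys (q k)"], THEN mp], intro conjI)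
    qed (use that \<gamma>_dec \<gamma>_1 ys_lim in simp_all)
    \<comment> \<open>PSNC of \<open>S2\<close> comes first: strong convergence of \<open>b\<close> to \<open>0\<close> is what forces \<open>\<mu>\<close> to tend to \<open>1\<close>.\<close>
    have b_lim: "(\<lambda>k. norm (b k)) \<longlonglongrightarrow> 0"
      using psncD[OF assms(10) P_mem(2) P2_lim _ N2] b_weak \<open>l = 0\<close> by simp
    have c_lim: "(\<lambda>k. norm (\<mu> k *\<^sub>R w k - b k)) \<longlonglongrightarrow> 0"
      using psncD[OF assms(9) P_mem(1) P1_lim _ N1] c_weak \<open>l = 0\<close> by simp
    have "(\<lambda>k. sqrt (1 - (norm (b k))\<^sup>2)) \<longlonglongrightarrow> sqrt (1 - 0\<^sup>2)"
      by (intro tendsto_intros b_lim)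
    moreover have "sqrt (1 - (norm (b k))\<^sup>2) = \<mu> k" for k
      using \<mu>[of k] by (intro real_sqrt_unique) auto
    ultimately have \<mu>_lim: "\<mu> \<longlonglongrightarrow> 1" by simp
    have "(\<lambda>k. (\<mu> k *\<^sub>R w k - b k) + b k) \<longlonglongrightarrow> 0 + 0"
      using b_lim c_lim by (intro tendsto_add) (auto simp: tendsto_norm_zero_iff)
    then have "(\<lambda>k. inverse (\<mu> k) *\<^sub>R (\<mu> k *\<^sub>R w k)) \<longlonglongrightarrow> inverse 1 *\<^sub>R 0"
      by (intro tendsto_scaleR tendsto_inverse \<mu>_lim) auto
    moreover have "eventually (\<lambda>k. inverse (\<mu> k) *\<^sub>R (\<mu> k *\<^sub>R w k) = w k) sequentially"
      using order_tendstoD(1)[OF \<mu>_lim, of 0] by (auto elim!: eventually_mono)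
    ultimately have "w \<longlonglongrightarrow> inverse 1 *\<^sub>R 0"
      by (rule Lim_transform_eventually)
    then have "w \<longlonglongrightarrow> 0" by simp
    then have "(\<lambda>k. w k - (w k - xs (q k))) \<longlonglongrightarrow> 0 - 0"
      by (intro tendsto_diff diff_lim)
    then have "(\<lambda>k. norm (xs (q k))) \<longlonglongrightarrow> 0" by (simp add: tendsto_norm_zero_iff)
    then have "\<delta> \<le> 0" using \<delta> by (intro LIMSEQ_le_const) (auto simp: q_def)
    then show False using \<open>\<delta> > 0\<close> by simp
  qed
  then show "(\<lambda>k. norm (xs k)) \<longlonglongrightarrow> 0" by (rule tendsto_norm_zero)
qed

end
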